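(* Let $\mathfrak U$ be a Grothendieck universe, let $L\in\mathfrak U$ be a first-order language and let $T$ be an $L$-theory. Then the categories $\mathbb{M}\mathrm{od}_{\mathfrak U}(T)$ and $\mathbb{M}\mathrm{od}^{\mathrm{str}}_{\mathfrak U}(T)$ are universal as structures in the language $L_{\mathrm{cat}}$ of categories. That is: if $\mathbb C$ is any small category which is $L_{\mathrm{cat}}$-elementarily equivalent to $\mathbb{M}\mathrm{od}_{\mathfrak U}(T)$ (respectively, to $\mathbb{M}\mathrm{od}^{\mathrm{str}}_{\mathfrak U}(T)$), then there is an embedding of categories $\mathbb C\hookrightarrow \mathbb{M}\mathrm{od}_{\mathfrak U}(T)$ (respectively, $\mathbb C\hookrightarrow\mathbb{M}\mathrm{od}^{\mathrm{str}}_{\mathfrak U}(T)$).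
   Context: A Grothendieck universe is a set $\mathfrak U$ that is transitive, closed under power sets, closed under unions $\bigcup_{i\in I}x_i$ with $I\in\mathfrak U$ and all $x_i\in\mathfrak U$, and contains $\omega$. Fix one. For a first-order language $L\in\mathfrak U$, $D(\mathcal N)$ denotes the underlying set of an $L$-structure $\mathcal N$, and $\mathcal N$ is small if $D(\mathcal N)\in\mathfrak U$. $\mathbb{M}\mathrm{od}_{\mathfrak U}(T)$ is the category whose objects are the small models of $T$ and whose morphisms are all $L$-homomorphisms. $\mathbb{M}\mathrm{od}^{\mathrm{str}}_{\mathfrak U}(T)$ has the same objects, but its morphisms are the strong homomorphisms, i.e. homomorphisms $f$ such that for each relation symbol $R$ a tuple satisfies $R$ if and only if its image under $f$ satisfies $R$. $L_{\mathrm{cat}}$ is the two-sorted language with an object sort and a morphism sort, a binary (partial) function $\circ$ on morphisms (composition), unary functions dom and rng from morphisms to objects, and a unary function Id from objects to morphisms (identity morphism). Composition is regarded as a partial function, defined only on composable pairs (equivalently, one uses its graph as a ternary relation). Every category is an $L_{\mathrm{cat}}$-structure, and elementary equivalence refers to first-order $L_{\mathrm{cat}}$-sentences (with equality). A category is small if both its set of objects and its set of morphisms are elements of $\mathfrak U$. An embedding of categories is a functor that is injective on objects and on morphisms. A structure $\mathcal M$ in a first-order language is universal if $D(\mathcal M)\subseteq\mathfrak U$ and every small structure elementarily equivalent to $\mathcal M$ embeds in $\mathcal M$. *)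

theory Defs
  imports Main
begin

(* The ambient set theory. A type of sort zfc is a universe of sets satisfying ZF, with separation
   and replacement for arbitrary HOL predicates and functions (second-order ZF); the axiom of
   choice then follows from Hilbert choice. "elts x" is the collection of all elements of x. *)

class zfc =
  fixes elts :: "'a \<Rightarrow> 'a set"
  assumes extensionality: "elts x = elts y \<Longrightarrow> x = y"
    and foundation: "elts x \<noteq> {} \<Longrightarrow> \<exists>y \<in> elts x. elts y \<inter> elts x = {}"
    and pairing: "\<exists>z. elts z = {x, y}"
    and union: "\<exists>z. elts z = (\<Union>y \<in> elts x. elts y)"
    and power_set: "\<exists>z. elts z = {y. elts y \<subseteq> elts x}"
    and separation: "\<exists>z. elts z = {y \<in> elts x. P y}"
    and replacement: "\<exists>z. elts z = f ` elts x"
    and infinity: "\<exists>w. (\<exists>e \<in> elts w. elts e = {})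
          \<and> (\<forall>x \<in> elts w. \<exists>y \<in> elts w. elts y = insert x (elts x))"

(* Meaningful only if X is the collection of all elements of some set. *)
definition vset :: "'v::zfc set \<Rightarrow> 'v" where
  "vset X = (THE z. elts z = X)"

definition vpow :: "'v::zfc \<Rightarrow> 'v" where
  "vpow x = vset {y. elts y \<subseteq> elts x}"

primrec vnat :: "nat \<Rightarrow> 'v::zfc" where
  "vnat 0 = vset {}"
| "vnat (Suc n) = vset (insert (vnat n) (elts (vnat n)))"

definition vomega :: "'v::zfc" where
  "vomega = vset (range vnat)"

definition grothendieck_universe :: "'v::zfc \<Rightarrow> bool" where
  "grothendieck_universe U \<longleftrightarrow>
     (\<forall>x \<in> elts U. elts x \<subseteq> elts U) \<and>
     (\<forall>x \<in> elts U. vpow x \<in> elts U) \<and>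
     (\<forall>I \<in> elts U. \<forall>x. (\<forall>i \<in> elts I. x i \<in> elts U) \<longrightarrow>
        vset (\<Union>i \<in> elts I. elts (x i)) \<in> elts U) \<and>
     vomega \<in> elts U"


subsection \<open>Ordered pairs, tuples and functions as sets\<close>

definition vpair :: "'v::zfc \<Rightarrow> 'v \<Rightarrow> 'v" where
  "vpair x y = vset {vset {x}, vset {x, y}}"

definition vfst :: "'v::zfc \<Rightarrow> 'v" where
  "vfst p = (THE x. \<exists>y. p = vpair x y)"

definition vsnd :: "'v::zfc \<Rightarrow> 'v" where
  "vsnd p = (THE y. \<exists>x. p = vpair x y)"

primrec vtuple :: "'v::zfc list \<Rightarrow> 'v" where
  "vtuple [] = vset {}"
| "vtuple (x # xs) = vpair x (vtuple xs)"

definition tuples :: "'v::zfc \<Rightarrow> nat \<Rightarrow> 'v set" where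
  "tuples D n = {vtuple xs | xs. length xs = n \<and> set xs \<subseteq> elts D}"

(* The set f is (the graph of) a function with domain X and values in Y. *)
definition vfunction :: "'v::zfc \<Rightarrow> 'v set \<Rightarrow> 'v set \<Rightarrow> bool" where
  "vfunction f X Y \<longleftrightarrow>
     elts f \<subseteq> {vpair x y | x y. x \<in> X \<and> y \<in> Y} \<and>
     (\<forall>x \<in> X. \<exists>!y. vpair x y \<in> elts f)"

definition vapp :: "'v::zfc \<Rightarrow> 'v \<Rightarrow> 'v" where
  "vapp f x = (THE y. vpair x y \<in> elts f)"

definition vlambda :: "'v::zfc \<Rightarrow> ('v \<Rightarrow> 'v) \<Rightarrow> 'v" where
  "vlambda A f = vset {vpair x (f x) | x. x \<in> elts A}"


subsection \<open>First-order languages, structures and theories\<close>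

(* A language is a pair (F, R), where F maps the function symbols and R the relation symbols to
   their arities in omega. Constants are the function symbols of arity 0. *)
definition language :: "'v::zfc \<Rightarrow> bool" where
  "language L \<longleftrightarrow> (\<exists>F R A B. L = vpair F R \<and>
     vfunction F (elts A) (elts vomega) \<and> vfunction R (elts B) (elts vomega))"

definition fun_syms :: "'v::zfc \<Rightarrow> 'v set" where
  "fun_syms L = {s. \<exists>n. vpair s n \<in> elts (vfst L)}"

definition rel_syms :: "'v::zfc \<Rightarrow> 'v set" where
  "rel_syms L = {s. \<exists>n. vpair s n \<in> elts (vsnd L)}"

definition fun_arity :: "'v::zfc \<Rightarrow> 'v \<Rightarrow> nat" where
  "fun_arity L s = (THE n. vapp (vfst L) s = vnat n)"

definition rel_arity :: "'v::zfc \<Rightarrow> 'v \<Rightarrow> nat" where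
  "rel_arity L s = (THE n. vapp (vsnd L) s = vnat n)"

datatype 'v trm = Var nat | Fn 'v "'v trm list"

datatype 'v fm =
    Eq "'v trm" "'v trm"
  | Rel 'v "'v trm list"
  | Neg "'v fm"
  | Conj "'v fm" "'v fm"
  | Ex nat "'v fm"

primrec wf_trm :: "'v::zfc \<Rightarrow> 'v trm \<Rightarrow> bool" where
  "wf_trm L (Var n) \<longleftrightarrow> True"
| "wf_trm L (Fn s ts) \<longleftrightarrow>
     s \<in> fun_syms L \<and> length ts = fun_arity L s \<and> list_all (wf_trm L) ts"

primrec wf_fm :: "'v::zfc \<Rightarrow> 'v fm \<Rightarrow> bool" where
  "wf_fm L (Eq t u) \<longleftrightarrow> wf_trm L t \<and> wf_trm L u"
| "wf_fm L (Rel s ts) \<longleftrightarrow>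
     s \<in> rel_syms L \<and> length ts = rel_arity L s \<and> list_all (wf_trm L) ts"
| "wf_fm L (Neg p) \<longleftrightarrow> wf_fm L p"
| "wf_fm L (Conj p q) \<longleftrightarrow> wf_fm L p \<and> wf_fm L q"
| "wf_fm L (Ex n p) \<longleftrightarrow> wf_fm L p"

primrec fv_trm :: "'v trm \<Rightarrow> nat set" where
  "fv_trm (Var n) = {n}"
| "fv_trm (Fn s ts) = \<Union> (set (map fv_trm ts))"

primrec fv_fm :: "'v fm \<Rightarrow> nat set" where
  "fv_fm (Eq t u) = fv_trm t \<union> fv_trm u"
| "fv_fm (Rel s ts) = \<Union> (set (map fv_trm ts))"
| "fv_fm (Neg p) = fv_fm p"
| "fv_fm (Conj p q) = fv_fm p \<union> fv_fm q"
| "fv_fm (Ex n p) = fv_fm p - {n}"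

definition theory_in :: "'v::zfc \<Rightarrow> 'v fm set \<Rightarrow> bool" where
  "theory_in L T \<longleftrightarrow> (\<forall>p \<in> T. wf_fm L p \<and> fv_fm p = {})"

(* A structure is a triple (D, (F, R)); F and R assign to each function and relation symbol its
   interpretation, a function D^n -> D or a subset of D^n. As usual, D is nonempty. *)
definition carrier :: "'v::zfc \<Rightarrow> 'v" where
  "carrier N = vfst N"

definition fun_interp :: "'v::zfc \<Rightarrow> 'v \<Rightarrow> 'v list \<Rightarrow> 'v" where
  "fun_interp N s xs = vapp (vapp (vfst (vsnd N)) s) (vtuple xs)"

definition rel_interp :: "'v::zfc \<Rightarrow> 'v \<Rightarrow> 'v list \<Rightarrow> bool" where
  "rel_interp N s xs \<longleftrightarrow> vtuple xs \<in> elts (vapp (vsnd (vsnd N)) s)"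

definition struct :: "'v::zfc \<Rightarrow> 'v \<Rightarrow> bool" where
  "struct L N \<longleftrightarrow> (\<exists>D F R. N = vpair D (vpair F R) \<and> elts D \<noteq> {} \<and>
     vfunction F (fun_syms L) UNIV \<and>
     (\<forall>s \<in> fun_syms L. vfunction (vapp F s) (tuples D (fun_arity L s)) (elts D)) \<and>
     vfunction R (rel_syms L) UNIV \<and>
     (\<forall>s \<in> rel_syms L. elts (vapp R s) \<subseteq> tuples D (rel_arity L s)))"

primrec eval_trm :: "'v::zfc \<Rightarrow> (nat \<Rightarrow> 'v) \<Rightarrow> 'v trm \<Rightarrow> 'v" where
  "eval_trm N a (Var n) = a n"
| "eval_trm N a (Fn s ts) = fun_interp N s (map (eval_trm N a) ts)"

primrec sat :: "'v::zfc \<Rightarrow> (nat \<Rightarrow> 'v) \<Rightarrow> 'v fm \<Rightarrow> bool" where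
  "sat N a (Eq t u) \<longleftrightarrow> eval_trm N a t = eval_trm N a u"
| "sat N a (Rel s ts) \<longleftrightarrow> rel_interp N s (map (eval_trm N a) ts)"
| "sat N a (Neg p) \<longleftrightarrow> \<not> sat N a p"
| "sat N a (Conj p q) \<longleftrightarrow> sat N a p \<and> sat N a q"
| "sat N a (Ex n p) \<longleftrightarrow> (\<exists>x \<in> elts (carrier N). sat N (a(n := x)) p)"

definition model_of :: "'v::zfc \<Rightarrow> 'v fm set \<Rightarrow> 'v \<Rightarrow> bool" where
  "model_of L T N \<longleftrightarrow> struct L N \<and>
     (\<forall>p \<in> T. \<forall>a. range a \<subseteq> elts (carrier N) \<longrightarrow> sat N a p)"

definition small_struct :: "'v::zfc \<Rightarrow> 'v \<Rightarrow> bool" where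
  "small_struct U N \<longleftrightarrow> carrier N \<in> elts U"

definition homomorphism :: "'v::zfc \<Rightarrow> 'v \<Rightarrow> 'v \<Rightarrow> 'v \<Rightarrow> bool" where
  "homomorphism L M N h \<longleftrightarrow>
     vfunction h (elts (carrier M)) (elts (carrier N)) \<and>
     (\<forall>s \<in> fun_syms L. \<forall>xs. length xs = fun_arity L s \<and> set xs \<subseteq> elts (carrier M) \<longrightarrow>
        vapp h (fun_interp M s xs) = fun_interp N s (map (vapp h) xs)) \<and>
     (\<forall>s \<in> rel_syms L. \<forall>xs. length xs = rel_arity L s \<and> set xs \<subseteq> elts (carrier M) \<longrightarrow>
        rel_interp M s xs \<longrightarrow> rel_interp N s (map (vapp h) xs))"

definition strong_homomorphism :: "'v::zfc \<Rightarrow> 'v \<Rightarrow> 'v \<Rightarrow> 'v \<Rightarrow> bool" where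
  "strong_homomorphism L M N h \<longleftrightarrow>
     homomorphism L M N h \<and>
     (\<forall>s \<in> rel_syms L. \<forall>xs. length xs = rel_arity L s \<and> set xs \<subseteq> elts (carrier M) \<longrightarrow>
        (rel_interp M s xs \<longleftrightarrow> rel_interp N s (map (vapp h) xs)))"


subsection \<open>Categories as structures for the language of categories\<close>

(* "Comp C g f" is g after f. It is meaningful only if "Dom C g = Rng C f"; every notion below
   uses it for composable pairs only. *)
record 'v cat_struct =
  Obj :: "'v set"
  Mor :: "'v set"
  Dom :: "'v \<Rightarrow> 'v"
  Rng :: "'v \<Rightarrow> 'v"
  Ident :: "'v \<Rightarrow> 'v"
  Comp :: "'v \<Rightarrow> 'v \<Rightarrow> 'v"

definition category :: "'v cat_struct \<Rightarrow> bool" where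
  "category C \<longleftrightarrow>
     (\<forall>f \<in> Mor C. Dom C f \<in> Obj C \<and> Rng C f \<in> Obj C) \<and>
     (\<forall>A \<in> Obj C. Ident C A \<in> Mor C \<and> Dom C (Ident C A) = A \<and> Rng C (Ident C A) = A) \<and>
     (\<forall>f \<in> Mor C. \<forall>g \<in> Mor C. Dom C g = Rng C f \<longrightarrow>
        Comp C g f \<in> Mor C \<and> Dom C (Comp C g f) = Dom C f \<and> Rng C (Comp C g f) = Rng C g) \<and>
     (\<forall>f \<in> Mor C. Comp C f (Ident C (Dom C f)) = f \<and> Comp C (Ident C (Rng C f)) f = f) \<and>
     (\<forall>f \<in> Mor C. \<forall>g \<in> Mor C. \<forall>h \<in> Mor C. Dom C g = Rng C f \<and> Dom C h = Rng C g \<longrightarrow>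
        Comp C h (Comp C g f) = Comp C (Comp C h g) f)"

definition small_category :: "'v::zfc \<Rightarrow> 'v cat_struct \<Rightarrow> bool" where
  "small_category U C \<longleftrightarrow> category C \<and>
     (\<exists>A \<in> elts U. elts A = Obj C) \<and> (\<exists>B \<in> elts U. elts B = Mor C)"

(* The two sorts have separate variables. *)
datatype obj_trm = OVar nat | DomT mor_trm | RngT mor_trm
     and mor_trm = MVar nat | IdT obj_trm

(* CompF g f h: g and f are composable with composite h (the graph of composition). *)
datatype cat_fm =
    OEq obj_trm obj_trm
  | MEq mor_trm mor_trm
  | CompF mor_trm mor_trm mor_trm
  | CNeg cat_fm
  | CConj cat_fm cat_fm
  | OEx nat cat_fm
  | MEx nat cat_fm

primrec fov_obj :: "obj_trm \<Rightarrow> nat set" and fov_mor :: "mor_trm \<Rightarrow> nat set" where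
  "fov_obj (OVar n) = {n}"
| "fov_obj (DomT t) = fov_mor t"
| "fov_obj (RngT t) = fov_mor t"
| "fov_mor (MVar n) = {}"
| "fov_mor (IdT t) = fov_obj t"

primrec fmv_obj :: "obj_trm \<Rightarrow> nat set" and fmv_mor :: "mor_trm \<Rightarrow> nat set" where
  "fmv_obj (OVar n) = {}"
| "fmv_obj (DomT t) = fmv_mor t"
| "fmv_obj (RngT t) = fmv_mor t"
| "fmv_mor (MVar n) = {n}"
| "fmv_mor (IdT t) = fmv_obj t"

primrec fov :: "cat_fm \<Rightarrow> nat set" where
  "fov (OEq t u) = fov_obj t \<union> fov_obj u"
| "fov (MEq t u) = fov_mor t \<union> fov_mor u"
| "fov (CompF t u v) = fov_mor t \<union> fov_mor u \<union> fov_mor v"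
| "fov (CNeg p) = fov p"
| "fov (CConj p q) = fov p \<union> fov q"
| "fov (OEx n p) = fov p - {n}"
| "fov (MEx n p) = fov p"

primrec fmv :: "cat_fm \<Rightarrow> nat set" where
  "fmv (OEq t u) = fmv_obj t \<union> fmv_obj u"
| "fmv (MEq t u) = fmv_mor t \<union> fmv_mor u"
| "fmv (CompF t u v) = fmv_mor t \<union> fmv_mor u \<union> fmv_mor v"
| "fmv (CNeg p) = fmv p"
| "fmv (CConj p q) = fmv p \<union> fmv q"
| "fmv (OEx n p) = fmv p"
| "fmv (MEx n p) = fmv p - {n}"

definition cat_sentence :: "cat_fm \<Rightarrow> bool" where
  "cat_sentence p \<longleftrightarrow> fov p = {} \<and> fmv p = {}"

primrec eval_obj :: "'v cat_struct \<Rightarrow> (nat \<Rightarrow> 'v) \<Rightarrow> (nat \<Rightarrow> 'v) \<Rightarrow> obj_trm \<Rightarrow> 'v"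
    and eval_mor :: "'v cat_struct \<Rightarrow> (nat \<Rightarrow> 'v) \<Rightarrow> (nat \<Rightarrow> 'v) \<Rightarrow> mor_trm \<Rightarrow> 'v" where
  "eval_obj C a b (OVar n) = a n"
| "eval_obj C a b (DomT t) = Dom C (eval_mor C a b t)"
| "eval_obj C a b (RngT t) = Rng C (eval_mor C a b t)"
| "eval_mor C a b (MVar n) = b n"
| "eval_mor C a b (IdT t) = Ident C (eval_obj C a b t)"

primrec cat_sat :: "'v cat_struct \<Rightarrow> (nat \<Rightarrow> 'v) \<Rightarrow> (nat \<Rightarrow> 'v) \<Rightarrow> cat_fm \<Rightarrow> bool" where
  "cat_sat C a b (OEq t u) \<longleftrightarrow> eval_obj C a b t = eval_obj C a b u"
| "cat_sat C a b (MEq t u) \<longleftrightarrow> eval_mor C a b t = eval_mor C a b u"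
| "cat_sat C a b (CompF t u v) \<longleftrightarrow>
     Dom C (eval_mor C a b t) = Rng C (eval_mor C a b u) \<and>
     Comp C (eval_mor C a b t) (eval_mor C a b u) = eval_mor C a b v"
| "cat_sat C a b (CNeg p) \<longleftrightarrow> \<not> cat_sat C a b p"
| "cat_sat C a b (CConj p q) \<longleftrightarrow> cat_sat C a b p \<and> cat_sat C a b q"
| "cat_sat C a b (OEx n p) \<longleftrightarrow> (\<exists>x \<in> Obj C. cat_sat C (a(n := x)) b p)"
| "cat_sat C a b (MEx n p) \<longleftrightarrow> (\<exists>x \<in> Mor C. cat_sat C a (b(n := x)) p)"

(* The truth value of a sentence does not depend on the assignments, so arbitrary ones are used;
   requiring them to take values in Obj C and Mor C would break down for the empty category,
   which must be allowed because a theory may have no models. *)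
definition cat_true :: "'v cat_struct \<Rightarrow> cat_fm \<Rightarrow> bool" where
  "cat_true C p \<longleftrightarrow> (\<forall>a b. cat_sat C a b p)"

definition elem_equiv :: "'v cat_struct \<Rightarrow> 'v cat_struct \<Rightarrow> bool" where
  "elem_equiv C C' \<longleftrightarrow> (\<forall>p. cat_sentence p \<longrightarrow> (cat_true C p \<longleftrightarrow> cat_true C' p))"

definition is_functor ::
  "'v cat_struct \<Rightarrow> 'v cat_struct \<Rightarrow> ('v \<Rightarrow> 'v) \<Rightarrow> ('v \<Rightarrow> 'v) \<Rightarrow> bool" where
  "is_functor C C' \<Phi> \<phi> \<longleftrightarrow>
     (\<forall>A \<in> Obj C. \<Phi> A \<in> Obj C') \<and>
     (\<forall>f \<in> Mor C. \<phi> f \<in> Mor C' \<and> Dom C' (\<phi> f) = \<Phi> (Dom C f) \<and> Rng C' (\<phi> f) = \<Phi> (Rng C f)) \<and>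
     (\<forall>A \<in> Obj C. \<phi> (Ident C A) = Ident C' (\<Phi> A)) \<and>
     (\<forall>f \<in> Mor C. \<forall>g \<in> Mor C. Dom C g = Rng C f \<longrightarrow> \<phi> (Comp C g f) = Comp C' (\<phi> g) (\<phi> f))"

definition cat_embedding ::
  "'v cat_struct \<Rightarrow> 'v cat_struct \<Rightarrow> ('v \<Rightarrow> 'v) \<Rightarrow> ('v \<Rightarrow> 'v) \<Rightarrow> bool" where
  "cat_embedding C C' \<Phi> \<phi> \<longleftrightarrow>
     is_functor C C' \<Phi> \<phi> \<and> inj_on \<Phi> (Obj C) \<and> inj_on \<phi> (Mor C)"

(* A small structure that is elementarily equivalent to a category is itself a category, since the
   axioms of categories are first-order. *)
definition universal_category :: "'v::zfc \<Rightarrow> 'v cat_struct \<Rightarrow> bool" where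
  "universal_category U M \<longleftrightarrow>
     Obj M \<subseteq> elts U \<and> Mor M \<subseteq> elts U \<and>
     (\<forall>C. small_category U C \<and> elem_equiv C M \<longrightarrow> (\<exists>\<Phi> \<phi>. cat_embedding C M \<Phi> \<phi>))"


subsection \<open>The categories of small models\<close>

(* A morphism is a triple (M, (h, N)) recording the source M and the target N of the map h. *)
definition models_with ::
  "('v::zfc \<Rightarrow> 'v \<Rightarrow> 'v \<Rightarrow> bool) \<Rightarrow> 'v \<Rightarrow> 'v \<Rightarrow> 'v fm set \<Rightarrow> 'v cat_struct" where
  "models_with hom U L T =
     \<lparr> Obj = {N. model_of L T N \<and> small_struct U N},
       Mor = {vpair M (vpair h N) | M h N.
                model_of L T M \<and> small_struct U M \<and> model_of L T N \<and> small_struct U N \<and>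
                hom M N h},
       Dom = vfst,
       Rng = (\<lambda>m. vsnd (vsnd m)),
       Ident = (\<lambda>N. vpair N (vpair (vlambda (carrier N) (\<lambda>x. x)) N)),
       Comp = (\<lambda>m' m. vpair (vfst m)
                (vpair (vlambda (carrier (vfst m))
                          (\<lambda>x. vapp (vfst (vsnd m')) (vapp (vfst (vsnd m)) x)))
                       (vsnd (vsnd m')))) \<rparr>"

definition Mod :: "'v::zfc \<Rightarrow> 'v \<Rightarrow> 'v fm set \<Rightarrow> 'v cat_struct" where
  "Mod U L T = models_with (homomorphism L) U L T"

definition Mod_str :: "'v::zfc \<Rightarrow> 'v \<Rightarrow> 'v fm set \<Rightarrow> 'v cat_struct" where
  "Mod_str U L T = models_with (strong_homomorphism L) U L T"

end

(* Let M be the category of models and C a small category elementarily equivalent to M. For every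
   finite set s of morphisms of C, an existential sentence describing the composition table of s
   holds in C, hence in M; so there is a map b s from the morphisms of C to those of M that is
   injective and functorial as far as s can see. Fix an ultrafilter F on the finite sets s that
   contains every cone {s. X \<subseteq> s}. An object A goes to the ultraproduct over F of the models that b s
   assigns to A, and a morphism f goes to the ultraproduct of the maps b s f. Los's theorem makes
   these ultraproducts models of T. Two distinct parallel morphisms f and g satisfy
   b s f \<noteq> b s g for almost all s, and a choice of points where they differ separates the limit
   maps. Tagging the elements of the ultraproduct with A makes the assignment injective on objects.
   Everything stays in U because the finite sets of morphisms of C form a set in U. *)

theory Submission
  imports Defs
begin

subsection \<open>Ultrafilters\<close>

definition ultra :: "'i filter \<Rightarrow> bool" where
  "ultra F \<longleftrightarrow> F \<noteq> bot \<and> (\<forall>P. eventually P F \<or> eventually (\<lambda>i. \<not> P i) F)"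

text \<open>Properness rules out that \<open>P\<close> and its negation both hold almost everywhere.
  This is what the negation case of Los's theorem needs.\<close>

lemma ultra_not: "ultra F \<Longrightarrow> eventually (\<lambda>i. \<not> P i) F \<longleftrightarrow> \<not> eventually P F"
proof -
  assume u: "ultra F"
  have "\<not> (eventually (\<lambda>i. \<not> P i) F \<and> eventually P F)"
  proof
    assume "eventually (\<lambda>i. \<not> P i) F \<and> eventually P F"
    then have "eventually (\<lambda>i. False) F"
      by (auto elim: eventually_elim2)
    then show False
      using u by (simp add: ultra_def trivial_limit_def)
  qed
  with u show ?thesis
    unfolding ultra_def by blast
qed

text \<open>A finer filter is smaller in the order on filters, so an ultrafilter is a minimal proper
  filter. Zorn's lemma provides one among the proper filters below \<open>F\<close>.\<close>

lemma ultrafilter_extension: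
  fixes F :: "'i filter"
  assumes "F \<noteq> bot"
  obtains G where "G \<le> F" "ultra G"
proof -
  define A where "A = {G. G \<le> F \<and> G \<noteq> bot}"
  have rel: "(x, y) \<in> relation_of (\<lambda>m a. a \<le> m) A \<longleftrightarrow> x \<in> A \<and> y \<in> A \<and> y \<le> x" for x y
    by (auto simp: relation_of_def)
  have "\<exists>m\<in>A. \<forall>a\<in>A. a \<le> m \<longrightarrow> a = m"
  proof (rule predicate_Zorn)
    show "partial_order_on A (relation_of (\<lambda>m a. a \<le> m) A)"
      by (rule partial_order_on_relation_ofI) auto
    show "\<exists>u\<in>A. \<forall>a\<in>B. u \<le> a" if B: "B \<in> Chains (relation_of (\<lambda>m a. a \<le> m) A)" for B
    proof (cases "B = {}")
      case True
      with assms show ?thesis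
        by (auto simp: A_def)
    next
      case False
      have sub: "B \<subseteq> A" and lin: "\<And>x y. x \<in> B \<Longrightarrow> y \<in> B \<Longrightarrow> x \<le> y \<or> y \<le> x"
        using B by (auto simp: Chains_def rel)
      \<comment> \<open>A chain is directed, so whatever holds eventually for its infimum already
        holds eventually for one of its members; all members are proper.\<close>
      have "\<not> eventually (\<lambda>_. False) (Inf B)"
      proof (subst eventually_Inf_base)
        show "B \<noteq> {}" by fact
        show "\<exists>x\<in>B. x \<le> inf G H" if "G \<in> B" "H \<in> B" for G H
          using that lin[of G H] by auto
        show "\<not> (\<exists>b\<in>B. eventually (\<lambda>_. False) b)"
          using sub by (auto simp: A_def trivial_limit_def)
      qed
      then have "Inf B \<noteq> bot"
        by (auto simp: trivial_limit_def)
      moreover have "Inf B \<le> F"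
        using False sub by (auto simp: A_def intro: Inf_lower2)
      ultimately show ?thesis
        by (auto simp: A_def intro: Inf_lower)
    qed
  qed
  then obtain G where G: "G \<le> F" "G \<noteq> bot"
    and max: "\<And>H. H \<le> F \<Longrightarrow> H \<noteq> bot \<Longrightarrow> H \<le> G \<Longrightarrow> H = G"
    by (auto simp: A_def)
  have "eventually P G" if "\<not> eventually (\<lambda>i. \<not> P i) G" for P
  proof -
    \<comment> \<open>Adding \<open>P\<close> to \<open>G\<close> keeps the filter proper because
      the negation of \<open>P\<close> is not in \<open>G\<close>; minimality then says that
      \<open>P\<close> was there already.\<close>
    let ?H = "inf G (principal {i. P i})"
    have "?H \<noteq> bot"
      using that by (auto simp: trivial_limit_def eventually_inf_principal)
    then have "?H = G"
      using G by (intro max) (auto intro: le_infI1)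
    moreover have "eventually P ?H"
      by (simp add: eventually_inf_principal)
    ultimately show ?thesis
      by simp
  qed
  with G show thesis
    by (intro that[of G]) (auto simp: ultra_def)
qed

subsection \<open>Coding in the ambient set theory\<close>

text \<open>Separates sets from proper classes; it is the side condition under which
  \<open>vset\<close> is inverse to \<open>elts\<close>.\<close>

definition is_set :: "'v::zfc set \<Rightarrow> bool" where
  "is_set X \<longleftrightarrow> (\<exists>z. elts z = X)"

lemma is_set_elts [simp, intro]: "is_set (elts x)"
  by (auto simp: is_set_def)

lemma vset_elts [simp]: "vset (elts x) = x"
  unfolding vset_def by (rule the_equality) (auto intro: extensionality)

lemma elts_vset [simp]: "is_set X \<Longrightarrow> elts (vset X) = X"
  by (auto simp: is_set_def)

lemma elts_inject: "elts x = elts y \<longleftrightarrow> x = y"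
  using extensionality by auto

lemma vset_eq_iff: "is_set X \<Longrightarrow> is_set Y \<Longrightarrow> vset X = vset Y \<longleftrightarrow> X = Y"
  using elts_vset by metis

lemma is_set_doubleton [simp]: "is_set {x, y}"
  unfolding is_set_def by (rule pairing)

lemma is_set_singleton [simp]: "is_set {x}"
  using is_set_doubleton[of x x] by simp

lemma is_set_subset: "is_set X \<Longrightarrow> Y \<subseteq> X \<Longrightarrow> is_set Y"
proof -
  assume "is_set X" "Y \<subseteq> X"
  then obtain z where z: "elts z = X"
    by (auto simp: is_set_def)
  obtain w where "elts w = {y \<in> elts z. y \<in> Y}"
    using separation[of z "\<lambda>y. y \<in> Y"] by auto
  then show ?thesis
    using z \<open>Y \<subseteq> X\<close> unfolding is_set_def by (intro exI[of _ w]) auto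
qed

lemma is_set_image: "is_set X \<Longrightarrow> is_set (f ` X)" for f :: "'v::zfc \<Rightarrow> 'v"
  using replacement[where f = f] by (auto simp: is_set_def)

lemma is_set_UN: "is_set X \<Longrightarrow> (\<And>x. x \<in> X \<Longrightarrow> is_set (f x)) \<Longrightarrow> is_set (\<Union>x\<in>X. f x)"
  for f :: "'v::zfc \<Rightarrow> 'v set"
proof -
  assume X: "is_set X" and f: "\<And>x. x \<in> X \<Longrightarrow> is_set (f x)"
  \<comment> \<open>Replacement speaks of functions whose values are sets in the sense of
    \<open>'v\<close>, so each collection \<open>f x\<close> is first coded by
    \<open>vset\<close>.\<close>
  obtain z where z: "elts z = (\<lambda>x. vset (f x)) ` X"
    using is_set_image[OF X, of "\<lambda>x. vset (f x)"] unfolding is_set_def by blast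
  obtain w where "elts w = (\<Union>y \<in> elts z. elts y)"
    using union[of z] by auto
  moreover have "elts (vset (f x)) = f x" if "x \<in> X" for x
    using f[OF that] by simp
  ultimately have "elts w = (\<Union>x\<in>X. f x)"
    using z by simp
  then show ?thesis
    unfolding is_set_def ..
qed

lemma is_set_Pow: "is_set X \<Longrightarrow> is_set {z. elts z \<subseteq> X}"
  using power_set by (auto simp: is_set_def)

lemma is_set_empty [simp]: "is_set {}"
  using is_set_subset[OF is_set_singleton] by blast

lemma vpair_eq_iff [simp]: "vpair x y = vpair x' y' \<longleftrightarrow> x = x' \<and> y = y'"
  by (auto simp: vpair_def vset_eq_iff doubleton_eq_iff)

lemma vfst_vpair [simp]: "vfst (vpair x y) = x"
  by (auto simp: vfst_def)

lemma vsnd_vpair [simp]: "vsnd (vpair x y) = y"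
  by (auto simp: vsnd_def)

lemma vtuple_inject: "length xs = length ys \<Longrightarrow> vtuple xs = vtuple ys \<longleftrightarrow> xs = ys"
  by (induction xs ys rule: list_induct2) auto

definition vprod :: "'v::zfc set \<Rightarrow> 'v set \<Rightarrow> 'v set" where
  "vprod X Y = {vpair x y | x y. x \<in> X \<and> y \<in> Y}"

lemma vprod_UN: "vprod X Y = (\<Union>x\<in>X. vpair x ` Y)"
  by (auto simp: vprod_def)

lemma is_set_vprod: "is_set X \<Longrightarrow> is_set Y \<Longrightarrow> is_set (vprod X Y)"
  by (simp add: vprod_UN is_set_UN is_set_image)

lemma tuples_0: "tuples D 0 = {vset {}}"
  by (auto simp: tuples_def)

text \<open>Reduces tuples to binary products, so that closure properties of products extend to
  \<open>tuples D n\<close> by induction on \<open>n\<close>.\<close>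

lemma tuples_Suc: "tuples D (Suc n) = vprod (elts D) (tuples D n)"
proof (rule set_eqI)
  fix z
  have "z \<in> tuples D (Suc n) \<longleftrightarrow> (\<exists>x xs. z = vpair x (vtuple xs) \<and> length xs = n \<and> x \<in> elts D \<and> set xs \<subseteq> elts D)"
    unfolding tuples_def by (auto simp: length_Suc_conv) (metis length_Cons set_ConsD subsetD subsetI vtuple.simps(2))
  also have "\<dots> \<longleftrightarrow> z \<in> vprod (elts D) (tuples D n)"
    by (auto simp: tuples_def vprod_def)
  finally show "z \<in> tuples D (Suc n) \<longleftrightarrow> z \<in> vprod (elts D) (tuples D n)" .
qed

lemma is_set_tuples: "is_set (tuples D n)"
  by (induction n) (simp_all add: tuples_0 tuples_Suc is_set_vprod)

lemma vfunction_vapp: "vfunction f X Y \<Longrightarrow> x \<in> X \<Longrightarrow> vpair x y \<in> elts f \<longleftrightarrow> vapp f x = y"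
proof -
  assume "vfunction f X Y" "x \<in> X"
  then have "\<exists>!y. vpair x y \<in> elts f"
    by (simp add: vfunction_def)
  then show ?thesis
    unfolding vapp_def by (auto intro: the1_equality theI')
qed

lemma vfunction_range: "vfunction f X Y \<Longrightarrow> x \<in> X \<Longrightarrow> vapp f x \<in> Y"
proof -
  assume f: "vfunction f X Y" and x: "x \<in> X"
  then have "vpair x (vapp f x) \<in> elts f"
    by (simp add: vfunction_vapp)
  with f show ?thesis
    unfolding vfunction_def by auto
qed

lemma vfunction_elts: "vfunction f X Y \<Longrightarrow> elts f = (\<lambda>x. vpair x (vapp f x)) ` X"
proof -
  assume f: "vfunction f X Y"
  then have "elts f \<subseteq> {vpair x y | x y. x \<in> X \<and> y \<in> Y}"
    by (simp add: vfunction_def)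
  then show ?thesis
    using vfunction_vapp[OF f] by fastforce
qed

text \<open>A function is its graph, so nothing depends on the codomain. Letting \<open>Y\<close>
  and \<open>Y'\<close> differ allows comparison with a \<open>vlambda\<close> for which only the
  codomain \<open>UNIV\<close> is at hand.\<close>

lemma vfunction_ext:
  "vfunction f X Y \<Longrightarrow> vfunction g X Y' \<Longrightarrow> (\<And>x. x \<in> X \<Longrightarrow> vapp f x = vapp g x) \<Longrightarrow> f = g"
  by (rule extensionality) (simp add: vfunction_elts)

lemma vfunction_image_graph:
  assumes "is_set X" "\<And>x. x \<in> X \<Longrightarrow> f x \<in> Y"
  shows "vfunction (vset ((\<lambda>x. vpair x (f x)) ` X)) X Y"
    and "x \<in> X \<Longrightarrow> vapp (vset ((\<lambda>x. vpair x (f x)) ` X)) x = f x"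
  using assms by (auto simp: vfunction_def vapp_def is_set_image)

lemma vlambda_image: "vlambda A f = vset ((\<lambda>x. vpair x (f x)) ` elts A)"
  by (simp add: vlambda_def setcompr_eq_image)

lemma vfunction_vlambda: "(\<And>x. x \<in> elts A \<Longrightarrow> f x \<in> Y) \<Longrightarrow> vfunction (vlambda A f) (elts A) Y"
  by (simp add: vlambda_image vfunction_image_graph)

lemma vapp_vlambda [simp]: "x \<in> elts A \<Longrightarrow> vapp (vlambda A f) x = f x"
  unfolding vlambda_image by (rule vfunction_image_graph(2)[where Y = UNIV]) auto

lemma is_set_domain: "is_set {s. \<exists>n. vpair s n \<in> elts G}"
proof (rule is_set_subset)
  show "is_set (vfst ` elts G)"
    by (intro is_set_image is_set_elts)
  show "{s. \<exists>n. vpair s n \<in> elts G} \<subseteq> vfst ` elts G"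
  proof safe
    fix s n
    assume "vpair s n \<in> elts G"
    from imageI[OF this, of vfst] show "s \<in> vfst ` elts G"
      by simp
  qed
qed

lemma is_set_syms [simp]: "is_set (fun_syms L)" "is_set (rel_syms L)"
  unfolding fun_syms_def rel_syms_def by (rule is_set_domain)+

subsection \<open>Closure properties of Grothendieck universes\<close>

text \<open>Smallness for collections, so that closure properties can be stated for unions, images
  and products without \<open>vset\<close> and its side conditions.\<close>

definition in_univ :: "'v::zfc \<Rightarrow> 'v set \<Rightarrow> bool" where
  "in_univ U X \<longleftrightarrow> (\<exists>z \<in> elts U. elts z = X)"

lemma in_univ_is_set: "in_univ U X \<Longrightarrow> is_set X"
  by (auto simp: in_univ_def is_set_def)

lemma in_univ_elts [simp]: "in_univ U (elts x) \<longleftrightarrow> x \<in> elts U"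
  by (auto simp: in_univ_def elts_inject)

lemma vset_in_univ: "in_univ U X \<Longrightarrow> vset X \<in> elts U"
  by (auto simp: in_univ_def)

locale univ =
  fixes U :: "'v::zfc"
  assumes U: "grothendieck_universe U"
begin

lemma transitive: "x \<in> elts U \<Longrightarrow> y \<in> elts x \<Longrightarrow> y \<in> elts U"
  using U by (auto simp: grothendieck_universe_def)

lemma in_univ_Pow: "in_univ U X \<Longrightarrow> in_univ U {z. elts z \<subseteq> X}"
proof -
  assume "in_univ U X"
  then obtain x where x: "x \<in> elts U" "elts x = X"
    by (auto simp: in_univ_def)
  then have "vpow x \<in> elts U"
    using U by (auto simp: grothendieck_universe_def)
  moreover have "elts (vpow x) = {z. elts z \<subseteq> elts x}"
    by (simp add: vpow_def is_set_Pow)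
  ultimately show ?thesis
    using x by (auto simp: in_univ_def)
qed

text \<open>A subset of an element of \<open>U\<close> belongs to the power set of that element, and
  \<open>U\<close> is transitive.\<close>

lemma in_univ_subset: "in_univ U X \<Longrightarrow> Y \<subseteq> X \<Longrightarrow> in_univ U Y"
proof -
  assume X: "in_univ U X" and Y: "Y \<subseteq> X"
  then have "is_set Y"
    by (blast intro: is_set_subset in_univ_is_set)
  moreover obtain p where "p \<in> elts U" "elts p = {z. elts z \<subseteq> X}"
    using in_univ_Pow[OF X] by (auto simp: in_univ_def)
  ultimately have "vset Y \<in> elts U"
    using transitive[of p "vset Y"] Y by simp
  then show ?thesis
    unfolding in_univ_def using elts_vset[OF \<open>is_set Y\<close>] by blast
qed

lemma in_univ_UN:
  assumes "in_univ U I" "\<And>i. i \<in> I \<Longrightarrow> in_univ U (f i)"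
  shows "in_univ U (\<Union>i\<in>I. f i)"
proof -
  obtain z where z: "z \<in> elts U" "elts z = I"
    using assms(1) by (auto simp: in_univ_def)
  have f: "vset (f i) \<in> elts U" "elts (vset (f i)) = f i" if "i \<in> I" for i
    using vset_in_univ elts_vset in_univ_is_set assms(2)[OF that] by blast+
  have "\<forall>I\<in>elts U. \<forall>x. (\<forall>i\<in>elts I. x i \<in> elts U) \<longrightarrow>
      vset (\<Union>i\<in>elts I. elts (x i)) \<in> elts U"
    using U by (simp add: grothendieck_universe_def)
  from this[rule_format, OF z(1), of "\<lambda>i. vset (f i)"]
  have "vset (\<Union>i\<in>elts z. elts (vset (f i))) \<in> elts U"
    using z f by simp
  moreover have "is_set (\<Union>i\<in>I. f i)"
    using assms by (intro is_set_UN in_univ_is_set) auto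
  ultimately show ?thesis
    unfolding in_univ_def using z f by (intro bexI[of _ "vset (\<Union>i\<in>I. f i)"]) auto
qed

lemma in_univ_singleton: "x \<in> elts U \<Longrightarrow> in_univ U {x}"
  by (rule in_univ_subset[OF in_univ_Pow[of "elts x"]]) auto

text \<open>Replacement inside \<open>U\<close> is closure under unions applied to the singletons
  \<open>{f i}\<close>.\<close>

lemma in_univ_image:
  assumes "in_univ U I" "\<And>i. i \<in> I \<Longrightarrow> f i \<in> elts U"
  shows "in_univ U (f ` I)"
proof -
  have "in_univ U (\<Union>i\<in>I. {f i})"
    using assms by (intro in_univ_UN in_univ_singleton)
  then show ?thesis
    by (simp add: UNION_singleton_eq_range)
qed

lemma empty_in_univ: "vset {} \<in> elts U"
proof -
  have "in_univ U (elts vomega)"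
    using U by (simp add: grothendieck_universe_def)
  then have "in_univ U {}"
    by (rule in_univ_subset) simp
  then show ?thesis
    by (rule vset_in_univ)
qed

text \<open>Pairing is derived by replacement: the power set of the singleton of the empty set has
  two elements, and these are sent to \<open>x\<close> and \<open>y\<close>.\<close>

lemma in_univ_doubleton:
  assumes "x \<in> elts U" "y \<in> elts U"
  shows "in_univ U {x, y}"
proof -
  let ?e = "vset {} :: 'v"
  have "in_univ U {?e}" "in_univ U {vset {?e}}"
    by (auto intro!: in_univ_singleton vset_in_univ empty_in_univ)
  have "in_univ U {z. elts z \<subseteq> {?e}}"
    by (intro in_univ_Pow in_univ_singleton empty_in_univ)
  then have "in_univ U ((\<lambda>z. if z = ?e then x else y) ` {z. elts z \<subseteq> {?e}})"
    by (rule in_univ_image) (auto simp: assms)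
  moreover have "{?e, vset {?e}} \<subseteq> {z. elts z \<subseteq> {?e}}" "vset {?e} \<noteq> ?e"
    by (auto simp: vset_eq_iff)
  ultimately show ?thesis
    by (elim in_univ_subset) force
qed

lemma vpair_in_univ: "x \<in> elts U \<Longrightarrow> y \<in> elts U \<Longrightarrow> vpair x y \<in> elts U"
  unfolding vpair_def by (intro vset_in_univ in_univ_doubleton in_univ_singleton)

lemma in_univ_vprod: "in_univ U X \<Longrightarrow> in_univ U Y \<Longrightarrow> in_univ U (vprod X Y)"
  unfolding vprod_UN
  by (intro in_univ_UN in_univ_image vpair_in_univ) (auto simp: in_univ_def intro: transitive)

lemma in_univ_tuples: "D \<in> elts U \<Longrightarrow> in_univ U (tuples D n)"
  by (induction n)
    (simp_all add: tuples_0 tuples_Suc in_univ_vprod in_univ_singleton empty_in_univ)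

lemma vfunction_in_univ: "vfunction f X Y \<Longrightarrow> in_univ U X \<Longrightarrow> in_univ U Y \<Longrightarrow> f \<in> elts U"
proof -
  assume f: "vfunction f X Y" and X: "in_univ U X" and Y: "in_univ U Y"
  have "elts f \<subseteq> vprod X Y"
    using f by (simp add: vfunction_def vprod_def)
  then have "in_univ U (elts f)"
    by (rule in_univ_subset[OF in_univ_vprod[OF X Y]])
  then show ?thesis
    by simp
qed

lemma in_univ_syms:
  assumes "language L" "L \<in> elts U"
  shows "in_univ U (fun_syms L)" "in_univ U (rel_syms L)"
proof -
  obtain F R where L: "L = vpair F R"
    using assms by (auto simp: language_def)
  \<comment> \<open>A Kuratowski pair contains \<open>{x, y}\<close>, so transitivity used twice
    recovers both components.\<close>
  have unpair: "x \<in> elts U \<and> y \<in> elts U" if "vpair x y \<in> elts U" for x y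
  proof -
    have "vset {x, y} \<in> elts U"
      using transitive[OF that] by (simp add: vpair_def)
    then show ?thesis
      using transitive[of "vset {x, y}"] by simp
  qed
  have dom: "in_univ U {s. \<exists>n. vpair s n \<in> elts G}" if "G \<in> elts U" for G
  proof (rule in_univ_subset)
    \<comment> \<open>For an arbitrary \<open>G\<close> the value of \<open>vfst\<close> is under
      control only on genuine pairs, hence the restriction to them.\<close>
    show "in_univ U (vfst ` {p \<in> elts G. \<exists>s n. p = vpair s n})"
    proof (rule in_univ_image)
      show "in_univ U {p \<in> elts G. \<exists>s n. p = vpair s n}"
        by (rule in_univ_subset[of "elts G"]) (auto simp: that)
      fix p
      assume "p \<in> {p \<in> elts G. \<exists>s n. p = vpair s n}"
      then obtain s n where "p = vpair s n" "vpair s n \<in> elts G"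
        by auto
      then show "vfst p \<in> elts U"
        using unpair[OF transitive[OF that]] by simp
    qed
    show "{s. \<exists>n. vpair s n \<in> elts G} \<subseteq> vfst ` {p \<in> elts G. \<exists>s n. p = vpair s n}"
      by (auto simp: image_iff) (metis vfst_vpair)
  qed
  show "in_univ U (fun_syms L)" "in_univ U (rel_syms L)"
    using dom unpair[of F R] assms(2) by (simp_all add: L fun_syms_def rel_syms_def)
qed

text \<open>Smallness bounds only the carrier. Each interpretation is a subset of a finite product
  of carriers, and the symbols form a set in \<open>U\<close> because \<open>L\<close> is in
  \<open>U\<close>.\<close>

lemma struct_in_univ:
  assumes L: "language L" "L \<in> elts U" and N: "struct L N" and small: "small_struct U N"
  shows "N \<in> elts U"
proof -
  obtain D F R where N_eq: "N = vpair D (vpair F R)"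
    and F: "vfunction F (fun_syms L) UNIV"
    and F': "\<And>s. s \<in> fun_syms L \<Longrightarrow> vfunction (vapp F s) (tuples D (fun_arity L s)) (elts D)"
    and R: "vfunction R (rel_syms L) UNIV"
    and R': "\<And>s. s \<in> rel_syms L \<Longrightarrow> elts (vapp R s) \<subseteq> tuples D (rel_arity L s)"
    using N unfolding struct_def by blast
  have D: "D \<in> elts U"
    using small by (simp add: small_struct_def carrier_def N_eq)
  have Fs: "vapp F s \<in> elts U" if "s \<in> fun_syms L" for s
    by (rule vfunction_in_univ[OF F'[OF that]]) (simp_all add: D in_univ_tuples)
  have Rs: "vapp R s \<in> elts U" if "s \<in> rel_syms L" for s
    using in_univ_subset[OF in_univ_tuples[OF D] R'[OF that]] by simp
  \<comment> \<open>The assignment of interpretations to symbols has no prescribed codomain, so its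
    graph is bounded through replacement and not through a product.\<close>
  have pairs: "G \<in> elts U"
    if "vfunction G X UNIV" "in_univ U X" "\<And>s. s \<in> X \<Longrightarrow> vapp G s \<in> elts U" for G X
  proof -
    have "in_univ U (elts G)"
      unfolding vfunction_elts[OF that(1)]
      using that(2,3) by (intro in_univ_image vpair_in_univ) (auto simp: in_univ_def intro: transitive)
    then show ?thesis
      by simp
  qed
  show ?thesis
    unfolding N_eq
    using pairs[OF F _ Fs] pairs[OF R _ Rs] in_univ_syms[OF L] D
    by (intro vpair_in_univ) auto
qed

end

subsection \<open>Ultraproducts\<close>

lemma struct_carrier_nonempty: "struct L N \<Longrightarrow> elts (carrier N) \<noteq> {}"
  by (auto simp: struct_def carrier_def)

lemma struct_fun_interp:
  assumes "struct L N" "s \<in> fun_syms L" "length xs = fun_arity L s" "set xs \<subseteq> elts (carrier N)"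
  shows "fun_interp N s xs \<in> elts (carrier N)"
proof -
  obtain D G R where "N = vpair D (vpair G R)"
    and "vfunction (vapp G s) (tuples D (fun_arity L s)) (elts D)"
    using assms(1,2) unfolding struct_def by blast
  with assms(3,4) show ?thesis
    by (auto simp: fun_interp_def carrier_def tuples_def intro!: vfunction_range)
qed

text \<open>Structures interpret symbols on coded tuples, while \<open>fun_interp\<close> and
  \<open>rel_interp\<close> take lists; this decodes a tuple of known length.\<close>

definition untuple :: "nat \<Rightarrow> 'v::zfc \<Rightarrow> 'v list" where
  "untuple n t = (THE xs. length xs = n \<and> vtuple xs = t)"

lemma untuple_vtuple [simp]: "length xs = n \<Longrightarrow> untuple n (vtuple xs) = xs"
  unfolding untuple_def by (rule the_equality) (auto simp: vtuple_inject)

(* The carrier D and the map q sending a family to its class are kept abstract, so that the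
   elements of D can be tagged; families need to lie in the carriers only almost everywhere. *)

locale ultraproduct =
  fixes L :: "'v::zfc" and F :: "'i filter" and N :: "'i \<Rightarrow> 'v"
    and q :: "('i \<Rightarrow> 'v) \<Rightarrow> 'v" and D :: 'v
  assumes ultra: "ultra F"
    and struct: "struct L (N i)"
    and elts_D: "elts D = q ` {x. \<forall>\<^sub>F i in F. x i \<in> elts (carrier (N i))}"
    and q_eq_iff: "\<forall>\<^sub>F i in F. x i \<in> elts (carrier (N i)) \<Longrightarrow>
      \<forall>\<^sub>F i in F. y i \<in> elts (carrier (N i)) \<Longrightarrow> q x = q y \<longleftrightarrow> (\<forall>\<^sub>F i in F. x i = y i)"
begin

definition fam :: "('i \<Rightarrow> 'v) set" where
  "fam = {x. \<forall>\<^sub>F i in F. x i \<in> elts (carrier (N i))}"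

definition rep :: "'v \<Rightarrow> 'i \<Rightarrow> 'v" where
  "rep = inv_into fam q"

text \<open>Operations and relations are evaluated coordinatewise on the chosen representatives
  \<open>rep\<close>. That any other representatives give the same result is the content of
  \<open>fun_interp_prod\<close> and \<open>rel_interp_prod\<close>.\<close>

definition prod :: 'v where
  "prod = vpair D (vpair
     (vlambda (vset (fun_syms L)) (\<lambda>s. vset ((\<lambda>t. vpair t
        (q (\<lambda>i. fun_interp (N i) s (map (\<lambda>z. rep z i) (untuple (fun_arity L s) t)))))
        ` tuples D (fun_arity L s))))
     (vlambda (vset (rel_syms L)) (\<lambda>s. vset {t \<in> tuples D (rel_arity L s).
        \<forall>\<^sub>F i in F. rel_interp (N i) s (map (\<lambda>z. rep z i) (untuple (rel_arity L s) t))})))"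

lemma elts_rel_prod:
  "s \<in> rel_syms L \<Longrightarrow> elts (vapp (vsnd (vsnd prod)) s) = {t \<in> tuples D (rel_arity L s).
    \<forall>\<^sub>F i in F. rel_interp (N i) s (map (\<lambda>z. rep z i) (untuple (rel_arity L s) t))}"
  unfolding prod_def vsnd_vpair
  by (subst vapp_vlambda) (simp, rule elts_vset, rule is_set_subset[OF is_set_tuples], blast)

lemma carrier_prod [simp]: "carrier prod = D"
  by (simp add: prod_def carrier_def)

lemma elts_D_fam: "elts D = q ` fam"
  by (simp add: elts_D fam_def)

lemma q_in_D [intro]: "x \<in> fam \<Longrightarrow> q x \<in> elts D"
  by (simp add: elts_D_fam)

lemma q_cong: "x \<in> fam \<Longrightarrow> \<forall>\<^sub>F i in F. x i = y i \<Longrightarrow> q x = q y \<and> y \<in> fam"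
proof -
  assume x: "x \<in> fam" and eq: "\<forall>\<^sub>F i in F. x i = y i"
  from eq x[unfolded fam_def mem_Collect_eq] have "\<forall>\<^sub>F i in F. y i \<in> elts (carrier (N i))"
    by eventually_elim simp
  then show ?thesis
    using x eq q_eq_iff by (simp add: fam_def)
qed

lemma rep: "z \<in> elts D \<Longrightarrow> rep z \<in> fam \<and> q (rep z) = z"
  unfolding elts_D_fam rep_def by (simp add: inv_into_into f_inv_into_f)

lemma rep_q: "x \<in> fam \<Longrightarrow> \<forall>\<^sub>F i in F. rep (q x) i = x i"
  using rep[OF q_in_D] q_eq_iff[of "rep (q x)" x] by (simp add: fam_def)

lemma D_nonempty: "elts D \<noteq> {}"
proof -
  have "\<exists>x. \<forall>i. x i \<in> elts (carrier (N i))"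
    using struct_carrier_nonempty[OF struct] by (intro choice) auto
  then have "fam \<noteq> {}"
    by (auto simp: fam_def intro: always_eventually)
  then show ?thesis
    by (simp add: elts_D_fam)
qed

text \<open>A list has finitely many entries, and finitely many statements that hold almost
  everywhere hold simultaneously almost everywhere.\<close>

lemma eventually_map_cong:
  assumes "\<And>x. x \<in> set xs \<Longrightarrow> \<forall>\<^sub>F i in F. f x i = g x i"
  shows "\<forall>\<^sub>F i in F. map (\<lambda>x. f x i) xs = map (\<lambda>x. g x i) xs"
proof -
  have "\<forall>\<^sub>F i in F. \<forall>x\<in>set xs. f x i = g x i"
    using assms by (simp add: eventually_ball_finite_distrib)
  then show ?thesis
    by eventually_elim auto
qed

lemma fam_fun_interp:
  assumes "s \<in> fun_syms L" "length xs = fun_arity L s" "set xs \<subseteq> fam"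
  shows "(\<lambda>i. fun_interp (N i) s (map (\<lambda>x. x i) xs)) \<in> fam"
proof -
  have "\<forall>\<^sub>F i in F. \<forall>x\<in>set xs. x i \<in> elts (carrier (N i))"
    using assms by (auto simp: eventually_ball_finite_distrib fam_def)
  then have "\<forall>\<^sub>F i in F. fun_interp (N i) s (map (\<lambda>x. x i) xs) \<in> elts (carrier (N i))"
    by eventually_elim (use assms in \<open>auto intro!: struct_fun_interp[OF struct]\<close>)
  then show ?thesis
    by (simp add: fam_def)
qed

lemma D_list_reps:
  assumes "set zs \<subseteq> elts D"
  obtains xs where "zs = map q xs" "set xs \<subseteq> fam" "length xs = length zs"
proof
  show "zs = map q (map rep zs)"
    using assms rep by (auto simp: map_idI subset_iff)
  show "set (map rep zs) \<subseteq> fam"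
    using assms rep by auto
qed simp

lemma fam_map_rep:
  assumes "s \<in> fun_syms L" "length zs = fun_arity L s" "set zs \<subseteq> elts D"
  shows "(\<lambda>i. fun_interp (N i) s (map (\<lambda>z. rep z i) zs)) \<in> fam"
  using fam_fun_interp[of s "map rep zs"] assms rep by (auto simp: o_def)

lemma struct_prod: "struct L prod"
  unfolding struct_def
proof (intro exI conjI ballI)
  show "elts D \<noteq> {}"
    by (rule D_nonempty)
  show "prod = vpair D (vpair (vfst (vsnd prod)) (vsnd (vsnd prod)))"
    by (simp add: prod_def)
  show "vfunction (vfst (vsnd prod)) (fun_syms L) UNIV"
    using vfunction_vlambda[of "vset (fun_syms L)"] by (simp add: prod_def)
  show "vfunction (vsnd (vsnd prod)) (rel_syms L) UNIV"
    using vfunction_vlambda[of "vset (rel_syms L)"] by (simp add: prod_def)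
  show "vfunction (vapp (vfst (vsnd prod)) s) (tuples D (fun_arity L s)) (elts D)"
    if "s \<in> fun_syms L" for s
  proof -
    have "vfunction (vset ((\<lambda>t. vpair t
        (q (\<lambda>i. fun_interp (N i) s (map (\<lambda>z. rep z i) (untuple (fun_arity L s) t)))))
        ` tuples D (fun_arity L s))) (tuples D (fun_arity L s)) (elts D)"
      by (rule vfunction_image_graph(1)[OF is_set_tuples])
        (use that in \<open>auto simp: tuples_def intro!: q_in_D fam_map_rep\<close>)
    then show ?thesis
      using that by (simp add: prod_def)
  qed
  show "elts (vapp (vsnd (vsnd prod)) s) \<subseteq> tuples D (rel_arity L s)"
    if "s \<in> rel_syms L" for s
    using that by (auto simp: elts_rel_prod)
qed

text \<open>The family \<open>rep (q x)\<close> agrees with \<open>x\<close> almost everywhere.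
  Exchanging them in the finitely many arguments changes the resulting family only on a negligible
  set, which \<open>q\<close> does not see.\<close>

lemma fun_interp_prod:
  assumes s: "s \<in> fun_syms L" "length xs = fun_arity L s" and xs: "set xs \<subseteq> fam"
  shows "fun_interp prod s (map q xs) = q (\<lambda>i. fun_interp (N i) s (map (\<lambda>x. x i) xs))"
proof -
  have D: "set (map q xs) \<subseteq> elts D"
    using xs by auto
  then have t: "vtuple (map q xs) \<in> tuples D (fun_arity L s)"
    using s unfolding tuples_def by fastforce
  have "fun_interp prod s (map q xs) =
      q (\<lambda>i. fun_interp (N i) s (map (\<lambda>z. rep z i) (map q xs)))"
    using s(1) vfunction_image_graph(2)[OF is_set_tuples _ t, where Y = UNIV]
    by (simp add: fun_interp_def prod_def s(2))
  also have "\<dots> = q (\<lambda>i. fun_interp (N i) s (map (\<lambda>x. x i) xs))"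
  proof -
    have "\<forall>\<^sub>F i in F. map (\<lambda>x. x i) xs = map (\<lambda>x. rep (q x) i) xs"
    proof (rule eventually_map_cong)
      show "\<forall>\<^sub>F i in F. x i = rep (q x) i" if "x \<in> set xs" for x
        using rep_q[of x] that xs by (auto simp: eq_commute)
    qed
    then have "\<forall>\<^sub>F i in F. fun_interp (N i) s (map (\<lambda>x. x i) xs) =
        fun_interp (N i) s (map (\<lambda>z. rep z i) (map q xs))"
      by eventually_elim (simp only: map_map o_def)
    from q_cong[OF fam_fun_interp[OF s xs] this] show ?thesis
      by simp
  qed
  finally show ?thesis .
qed

lemma rel_interp_prod:
  assumes s: "s \<in> rel_syms L" "length xs = rel_arity L s" and xs: "set xs \<subseteq> fam"
  shows "rel_interp prod s (map q xs) \<longleftrightarrow> (\<forall>\<^sub>F i in F. rel_interp (N i) s (map (\<lambda>x. x i) xs))"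
proof -
  have D: "set (map q xs) \<subseteq> elts D"
    using xs by auto
  then have t: "vtuple (map q xs) \<in> tuples D (rel_arity L s)"
    using s unfolding tuples_def by fastforce
  have "\<forall>\<^sub>F i in F. map (\<lambda>x. rep (q x) i) xs = map (\<lambda>x. x i) xs"
    using xs by (intro eventually_map_cong rep_q) auto
  then have "\<forall>\<^sub>F i in F. rel_interp (N i) s (map (\<lambda>z. rep z i) (map q xs)) \<longleftrightarrow>
      rel_interp (N i) s (map (\<lambda>x. x i) xs)"
    by eventually_elim (simp only: map_map o_def)
  then have "(\<forall>\<^sub>F i in F. rel_interp (N i) s (map (\<lambda>z. rep z i) (map q xs))) \<longleftrightarrow>
      (\<forall>\<^sub>F i in F. rel_interp (N i) s (map (\<lambda>x. x i) xs))"
    by (rule eventually_subst)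
  then show ?thesis
    using t unfolding rel_interp_def[of prod] elts_rel_prod[OF s(1)] by (simp add: s(2))
qed

section \<open>Los's theorem and the models obtained from it\<close>

lemma eval_trm_prod:
  assumes "wf_trm L t" "\<And>n. x n \<in> fam"
  shows "(\<lambda>i. eval_trm (N i) (\<lambda>n. x n i) t) \<in> fam \<and>
    eval_trm prod (\<lambda>n. q (x n)) t = q (\<lambda>i. eval_trm (N i) (\<lambda>n. x n i) t)"
  using assms(1)
proof (induction t)
  case (Var n)
  with assms(2) show ?case
    by simp
next
  case (Fn s ts)
  let ?xs = "map (\<lambda>t i. eval_trm (N i) (\<lambda>n. x n i) t) ts"
  from Fn have s: "s \<in> fun_syms L" "length ?xs = fun_arity L s"
    and IH: "\<And>t. t \<in> set ts \<Longrightarrow> (\<lambda>i. eval_trm (N i) (\<lambda>n. x n i) t) \<in> fam"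
      "\<And>t. t \<in> set ts \<Longrightarrow>
        eval_trm prod (\<lambda>n. q (x n)) t = q (\<lambda>i. eval_trm (N i) (\<lambda>n. x n i) t)"
    by (auto simp: list_all_iff)
  have xs: "set ?xs \<subseteq> fam"
    using IH by auto
  have "map (eval_trm prod (\<lambda>n. q (x n))) ts = map q ?xs"
    using IH by simp
  then show ?case
    using fam_fun_interp[OF s xs] fun_interp_prod[OF s xs]
    unfolding eval_trm.simps by (simp add: o_def del: map_eq_conv)
qed

text \<open>Induction on the formula. Atomic formulas are computed coordinatewise, negation uses
  that the ultrafilter decides every predicate, and the existential quantifier uses a choice of
  witnesses in the factors.\<close>

lemma Los:
  assumes "wf_fm L p" "\<And>n. x n \<in> fam"
  shows "sat prod (\<lambda>n. q (x n)) p \<longleftrightarrow> (\<forall>\<^sub>F i in F. sat (N i) (\<lambda>n. x n i) p)"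
  using assms
proof (induction p arbitrary: x)
  case (Eq t u)
  then show ?case
    using eval_trm_prod[of t x] eval_trm_prod[of u x] q_eq_iff by (auto simp: fam_def)
next
  case (Rel s ts)
  let ?xs = "map (\<lambda>t i. eval_trm (N i) (\<lambda>n. x n i) t) ts"
  have s: "s \<in> rel_syms L" "length ?xs = rel_arity L s" and wf: "\<And>t. t \<in> set ts \<Longrightarrow> wf_trm L t"
    using Rel by (auto simp: list_all_iff)
  have xs: "set ?xs \<subseteq> fam" and eq: "map (eval_trm prod (\<lambda>n. q (x n))) ts = map q ?xs"
    using eval_trm_prod[OF wf, where x = x] Rel by auto
  show ?case
    using rel_interp_prod[OF s xs] unfolding sat.simps eq by (simp add: o_def)
next
  case (Neg p)
  then show ?case
    using ultra_not[OF ultra] by simp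
next
  case (Conj p r)
  then show ?case
    by (simp add: eventually_conj_iff)
next
  case (Ex k p)
  \<comment> \<open>Updating the assignment of families at \<open>k\<close> commutes with taking
    classes and with passing to a coordinate, so the induction hypothesis applies to
    \<open>x(k := y)\<close>.\<close>
  have upd: "sat prod ((\<lambda>n. q (x n))(k := q y)) p \<longleftrightarrow>
      (\<forall>\<^sub>F i in F. sat (N i) ((\<lambda>n. x n i)(k := y i)) p)" if "y \<in> fam" for y
  proof -
    have "(\<lambda>n. q ((x(k := y)) n)) = (\<lambda>n. q (x n))(k := q y)"
      "(\<lambda>n. (x(k := y)) n i) = (\<lambda>n. x n i)(k := y i)" for i
      by auto
    then show ?thesis
      using Ex.IH[of "x(k := y)"] Ex.prems that by simp
  qed
  have "(\<exists>y\<in>fam. \<forall>\<^sub>F i in F. sat (N i) ((\<lambda>n. x n i)(k := y i)) p) \<longleftrightarrow>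
      (\<forall>\<^sub>F i in F. \<exists>z\<in>elts (carrier (N i)). sat (N i) ((\<lambda>n. x n i)(k := z)) p)" (is "?l \<longleftrightarrow> ?r")
  proof
    assume ?l
    then obtain y where y: "\<forall>\<^sub>F i in F. y i \<in> elts (carrier (N i))"
      "\<forall>\<^sub>F i in F. sat (N i) ((\<lambda>n. x n i)(k := y i)) p"
      by (auto simp: fam_def)
    then show ?r
      by eventually_elim auto
  next
    assume r: ?r
    \<comment> \<open>A witness is picked at every index that has one; at the others the value is
      arbitrary, which membership in \<open>fam\<close> tolerates.\<close>
    define y where
      "y i = (SOME z. z \<in> elts (carrier (N i)) \<and> sat (N i) ((\<lambda>n. x n i)(k := z)) p)" for i
    from r have "\<forall>\<^sub>F i in F. y i \<in> elts (carrier (N i)) \<and> sat (N i) ((\<lambda>n. x n i)(k := y i)) p"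
    proof eventually_elim
      case (elim i)
      then have "\<exists>z. z \<in> elts (carrier (N i)) \<and> sat (N i) ((\<lambda>n. x n i)(k := z)) p"
        by blast
      then show ?case
        unfolding y_def by (rule someI_ex)
    qed
    then show ?l
      by (auto simp: fam_def eventually_conj_iff)
  qed
  then show ?case
    using upd by (simp add: elts_D_fam)
qed

lemma model_of_prod:
  assumes "theory_in L T" "\<And>i. model_of L T (N i)"
  shows "model_of L T prod"
  unfolding model_of_def
proof (intro conjI ballI allI impI)
  show "struct L prod"
    by (rule struct_prod)
  fix p and a :: "nat \<Rightarrow> 'v"
  assume p: "p \<in> T" and a: "range a \<subseteq> elts (carrier prod)"
  have x: "rep (a n) \<in> fam" "q (rep (a n)) = a n" for n
    using a rep[of "a n"] by auto
  have wf: "wf_fm L p"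
    using assms p by (auto simp: theory_in_def)
  \<comment> \<open>The representative of \<open>a n\<close> leaves the carriers on a negligible set
    that varies with \<open>n\<close>, and infinitely many such sets need not have a negligible
    union. Correcting every value gives an assignment into each factor \<open>N i\<close> for all
    variables at once.\<close>
  define b where "b i n = (if rep (a n) i \<in> elts (carrier (N i)) then rep (a n) i
    else SOME z. z \<in> elts (carrier (N i)))" for i n
  have b_in: "b i n \<in> elts (carrier (N i))" for i n
    using struct_carrier_nonempty[OF struct] by (auto simp: b_def some_in_eq)
  have eq: "\<forall>\<^sub>F i in F. rep (a n) i = b i n" for n
    using x(1)[of n, unfolded fam_def mem_Collect_eq] by eventually_elim (simp add: b_def)
  have "sat (N i) (\<lambda>n. b i n) p" for i
    using assms(2)[of i] p b_in unfolding model_of_def by blast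
  moreover have "(\<lambda>i. b i n) \<in> fam" "q (\<lambda>i. b i n) = a n" for n
    using q_cong[OF x(1) eq, of n] x(2) by auto
  ultimately show "sat prod a p"
    using Los[OF wf, of "\<lambda>n i. b i n"] by simp
qed

end

section \<open>Maps between ultraproducts induced by maps between the factors\<close>

locale ultraproduct_map =
  dom: ultraproduct L F N q D + cod: ultraproduct L F N' q' D'
  for L :: "'v::zfc" and F :: "'i filter" and N q D N' q' D' +
  fixes h :: "'i \<Rightarrow> 'v"
  assumes vfunction_h:
    "\<forall>\<^sub>F i in F. vfunction (h i) (elts (carrier (N i))) (elts (carrier (N' i)))"
begin

text \<open>At the negligible set of indices where \<open>h i\<close> is not a function between the
  carriers, \<open>vapp\<close> returns an unspecified value; the class taken by \<open>q'\<close>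
  does not depend on it.\<close>

definition prod_map :: 'v where
  "prod_map = vlambda D (\<lambda>z. q' (\<lambda>i. vapp (h i) (dom.rep z i)))"

lemma fam_vapp: "x \<in> dom.fam \<Longrightarrow> (\<lambda>i. vapp (h i) (x i)) \<in> cod.fam"
proof -
  assume "x \<in> dom.fam"
  then have "\<forall>\<^sub>F i in F. x i \<in> elts (carrier (N i))"
    by (simp add: dom.fam_def)
  with vfunction_h have "\<forall>\<^sub>F i in F. vapp (h i) (x i) \<in> elts (carrier (N' i))"
    by eventually_elim (rule vfunction_range)
  then show ?thesis
    by (simp add: cod.fam_def)
qed

lemma vfunction_prod_map: "vfunction prod_map (elts D) (elts D')"
  unfolding prod_map_def using dom.rep by (intro vfunction_vlambda cod.q_in_D fam_vapp) auto

lemma vapp_prod_map: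
  assumes "x \<in> dom.fam"
  shows "vapp prod_map (q x) = q' (\<lambda>i. vapp (h i) (x i))"
proof -
  from dom.rep_q[OF assms] have "\<forall>\<^sub>F i in F. vapp (h i) (x i) = vapp (h i) (dom.rep (q x) i)"
    by eventually_elim simp
  from cod.q_cong[OF fam_vapp[OF assms] this] show ?thesis
    using assms by (simp add: prod_map_def dom.q_in_D)
qed

lemma map_vapp_prod_map:
  "set xs \<subseteq> dom.fam \<Longrightarrow>
    map (vapp prod_map) (map q xs) = map q' (map (\<lambda>x i. vapp (h i) (x i)) xs)"
  by (auto simp: vapp_prod_map)

text \<open>Each clause involves one symbol and finitely many families, so it may be checked at the
  indices where \<open>h i\<close> is a homomorphism and all families lie in the carriers. These are
  almost all indices.\<close>

lemma homomorphism_prod_map: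
  assumes hom: "\<forall>\<^sub>F i in F. homomorphism L (N i) (N' i) (h i)"
  shows "homomorphism L dom.prod cod.prod prod_map"
  unfolding homomorphism_def dom.carrier_prod cod.carrier_prod
proof (intro conjI ballI allI impI; (elim conjE)?)
  show "vfunction prod_map (elts D) (elts D')"
    by (rule vfunction_prod_map)
next
  fix s zs
  assume s: "s \<in> fun_syms L" "length zs = fun_arity L s" and "set zs \<subseteq> elts D"
  then obtain xs where zs: "zs = map q xs" and xs: "set xs \<subseteq> dom.fam"
    and len: "length xs = fun_arity L s"
    using dom.D_list_reps by metis
  have hxs: "set (map (\<lambda>x i. vapp (h i) (x i)) xs) \<subseteq> cod.fam"
    using xs by (auto intro: fam_vapp)
  have "\<forall>\<^sub>F i in F. \<forall>x\<in>set xs. x i \<in> elts (carrier (N i))"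
    using xs by (auto simp: eventually_ball_finite_distrib dom.fam_def)
  with hom have "\<forall>\<^sub>F i in F. vapp (h i) (fun_interp (N i) s (map (\<lambda>x. x i) xs)) =
      fun_interp (N' i) s (map (\<lambda>x. vapp (h i) (x i)) xs)"
  proof eventually_elim
    case (elim i)
    then have "set (map (\<lambda>x. x i) xs) \<subseteq> elts (carrier (N i))"
      by auto
    with elim(1) s(1) len
    have "vapp (h i) (fun_interp (N i) s (map (\<lambda>x. x i) xs)) =
        fun_interp (N' i) s (map (vapp (h i)) (map (\<lambda>x. x i) xs))"
      unfolding homomorphism_def by (metis length_map)
    then show ?case
      by (simp add: o_def)
  qed
  from cod.q_cong[OF fam_vapp[OF dom.fam_fun_interp[OF s(1) len xs]] this]
  show "vapp prod_map (fun_interp dom.prod s zs) =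
      fun_interp cod.prod s (map (vapp prod_map) zs)"
    unfolding zs map_vapp_prod_map[OF xs] dom.fun_interp_prod[OF s(1) len xs]
    using cod.fun_interp_prod[OF s(1) _ hxs] len
    by (simp add: vapp_prod_map dom.fam_fun_interp s(1) xs o_def)
next
  fix s zs
  assume s: "s \<in> rel_syms L" "length zs = rel_arity L s" and "set zs \<subseteq> elts D"
    and rel: "rel_interp dom.prod s zs"
  then obtain xs where zs: "zs = map q xs" and xs: "set xs \<subseteq> dom.fam"
    and len: "length xs = rel_arity L s"
    using dom.D_list_reps by metis
  have hxs: "set (map (\<lambda>x i. vapp (h i) (x i)) xs) \<subseteq> cod.fam"
    using xs by (auto intro: fam_vapp)
  have "\<forall>\<^sub>F i in F. \<forall>x\<in>set xs. x i \<in> elts (carrier (N i))"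
    using xs by (auto simp: eventually_ball_finite_distrib dom.fam_def)
  moreover have "\<forall>\<^sub>F i in F. rel_interp (N i) s (map (\<lambda>x. x i) xs)"
    using rel dom.rel_interp_prod[OF s(1) len xs] by (simp add: zs)
  ultimately have "\<forall>\<^sub>F i in F. rel_interp (N' i) s (map (\<lambda>x. vapp (h i) (x i)) xs)"
    using hom
  proof eventually_elim
    case (elim i)
    then have "set (map (\<lambda>x. x i) xs) \<subseteq> elts (carrier (N i))"
      by auto
    with elim(2,3) s(1) len
    have "rel_interp (N' i) s (map (vapp (h i)) (map (\<lambda>x. x i) xs))"
      unfolding homomorphism_def by (metis length_map)
    then show ?case
      by (simp add: o_def)
  qed
  then show "rel_interp cod.prod s (map (vapp prod_map) zs)"
    unfolding zs map_vapp_prod_map[OF xs]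
    using cod.rel_interp_prod[OF s(1) _ hxs] len by (simp add: o_def)
qed

text \<open>If two predicates are equivalent at almost all indices, then one holds almost everywhere
  exactly when the other does; so reflection of relations passes to the ultraproduct.\<close>

lemma strong_homomorphism_prod_map:
  assumes hom: "\<forall>\<^sub>F i in F. strong_homomorphism L (N i) (N' i) (h i)"
  shows "strong_homomorphism L dom.prod cod.prod prod_map"
  unfolding strong_homomorphism_def
proof (intro conjI ballI allI impI; (elim conjE)?)
  show "homomorphism L dom.prod cod.prod prod_map"
    using hom by (intro homomorphism_prod_map) (auto simp: strong_homomorphism_def elim: eventually_mono)
next
  fix s zs
  assume s: "s \<in> rel_syms L" "length zs = rel_arity L s" and "set zs \<subseteq> elts (carrier dom.prod)"
  then obtain xs where zs: "zs = map q xs" and xs: "set xs \<subseteq> dom.fam"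
    and len: "length xs = rel_arity L s"
    using dom.D_list_reps by (metis dom.carrier_prod)
  have hxs: "set (map (\<lambda>x i. vapp (h i) (x i)) xs) \<subseteq> cod.fam"
    using xs by (auto intro: fam_vapp)
  have "\<forall>\<^sub>F i in F. \<forall>x\<in>set xs. x i \<in> elts (carrier (N i))"
    using xs by (auto simp: eventually_ball_finite_distrib dom.fam_def)
  with hom have "\<forall>\<^sub>F i in F. rel_interp (N i) s (map (\<lambda>x. x i) xs) \<longleftrightarrow>
      rel_interp (N' i) s (map (\<lambda>x. vapp (h i) (x i)) xs)"
  proof eventually_elim
    case (elim i)
    then have "set (map (\<lambda>x. x i) xs) \<subseteq> elts (carrier (N i))"
      by auto
    with elim(1) s(1) len
    have "rel_interp (N i) s (map (\<lambda>x. x i) xs) \<longleftrightarrow>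
        rel_interp (N' i) s (map (vapp (h i)) (map (\<lambda>x. x i) xs))"
      unfolding strong_homomorphism_def by (metis length_map)
    then show ?case
      by (simp add: o_def)
  qed
  then have "(\<forall>\<^sub>F i in F. rel_interp (N i) s (map (\<lambda>x. x i) xs)) \<longleftrightarrow>
      (\<forall>\<^sub>F i in F. rel_interp (N' i) s (map (\<lambda>x. vapp (h i) (x i)) xs))"
    by (rule eventually_subst)
  then show "rel_interp dom.prod s zs \<longleftrightarrow> rel_interp cod.prod s (map (vapp prod_map) zs)"
    unfolding zs map_vapp_prod_map[OF xs] dom.rel_interp_prod[OF s(1) len xs]
    using cod.rel_interp_prod[OF s(1) _ hxs] len by (simp add: o_def)
qed

end

text \<open>Equivalence classes of families are collections of HOL functions, not sets. A class is
  therefore coded by the graph of one chosen member, with indices coded by \<open>e\<close>. The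
  graphs are subsets of one collection \<open>W\<close> that is small, so the tagged codes form an
  element of \<open>U\<close>. Almost all indices lie in \<open>I\<close>, so a graph over
  \<open>I\<close> determines the class.\<close>

lemma (in univ) ultraproduct_in_univ:
  fixes F :: "'i filter" and e :: "'i \<Rightarrow> 'v" and N :: "'i \<Rightarrow> 'v"
  assumes ultra: "ultra F" and I: "\<forall>\<^sub>F i in F. i \<in> I"
    and e: "inj_on e I" "in_univ U (e ` I)"
    and A: "A \<in> elts U"
    and N: "\<And>i. struct L (N i)" "\<And>i. carrier (N i) \<in> elts U"
  obtains q D where "ultraproduct L F N q D" "D \<in> elts U" "\<And>z. z \<in> elts D \<Longrightarrow> vfst z = A"
proof -
  let ?P = "{x. \<forall>\<^sub>F i in F. x i \<in> elts (carrier (N i))}"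
  define W where "W = vprod (e ` I) (\<Union>j\<in>e ` I. elts (carrier (N (inv_into I e j))))"
  \<comment> \<open>The predicate under \<open>SOME\<close> depends only on the class of
    \<open>x\<close>, so families equal almost everywhere get the same member \<open>c x\<close>.
    This member lies in the carriers everywhere, as the bound by \<open>W\<close> requires.\<close>
  define c where "c x = (SOME y. (\<forall>i. y i \<in> elts (carrier (N i))) \<and> (\<forall>\<^sub>F i in F. y i = x i))" for x
  define graph where "graph y = vset ((\<lambda>i. vpair (e i) (y i)) ` I)" for y
  define q where "q x = vpair A (graph (c x))" for x
  define D where "D = vset (q ` ?P)"
  have W: "in_univ U W"
    unfolding W_def using e N(2) by (intro in_univ_vprod in_univ_UN) auto
  have c: "(\<forall>i. c x i \<in> elts (carrier (N i))) \<and> (\<forall>\<^sub>F i in F. c x i = x i)" if "x \<in> ?P" for x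
  proof -
    define y where "y i = (if x i \<in> elts (carrier (N i)) then x i
      else SOME z. z \<in> elts (carrier (N i)))" for i
    have "y i \<in> elts (carrier (N i))" for i
      using struct_carrier_nonempty[OF N(1)] by (auto simp: y_def some_in_eq)
    moreover from that[unfolded mem_Collect_eq] have "\<forall>\<^sub>F i in F. y i = x i"
      by eventually_elim (simp add: y_def)
    ultimately have "\<exists>y. (\<forall>i. y i \<in> elts (carrier (N i))) \<and> (\<forall>\<^sub>F i in F. y i = x i)"
      by blast
    from someI_ex[OF this] show ?thesis
      unfolding c_def .
  qed
  have sub: "(\<lambda>i. vpair (e i) (y i)) ` I \<subseteq> W" if "\<And>i. y i \<in> elts (carrier (N i))" for y
    using that e(1) by (auto simp: W_def vprod_def)
  have elts_graph: "elts (graph y) = (\<lambda>i. vpair (e i) (y i)) ` I"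
    if "\<And>i. y i \<in> elts (carrier (N i))" for y
    unfolding graph_def using is_set_subset[OF in_univ_is_set[OF W] sub[OF that]] by simp
  have "q ` ?P \<subseteq> vpair A ` {z. elts z \<subseteq> W}"
  proof (intro image_subsetI)
    fix x
    assume "x \<in> ?P"
    then have "\<And>i. c x i \<in> elts (carrier (N i))"
      using c by blast
    from elts_graph[of "c x", OF this] sub[of "c x", OF this]
    show "q x \<in> vpair A ` {z. elts z \<subseteq> W}"
      by (simp add: q_def)
  qed
  moreover have "in_univ U (vpair A ` {z. elts z \<subseteq> W})"
    using in_univ_Pow[OF W] by (intro in_univ_image vpair_in_univ A) (auto simp: in_univ_def intro: transitive)
  ultimately have P: "in_univ U (q ` ?P)"
    using in_univ_subset by blast
  then have elts_D: "elts D = q ` ?P"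
    using in_univ_is_set[OF P] by (simp add: D_def)
  from P have "D \<in> elts U"
    unfolding D_def by (rule vset_in_univ)
  moreover have "vfst z = A" if "z \<in> elts D" for z
    using that by (auto simp: elts_D q_def)
  moreover have "ultraproduct L F N q D"
  proof
    show "q x = q y \<longleftrightarrow> (\<forall>\<^sub>F i in F. x i = y i)"
      if "\<forall>\<^sub>F i in F. x i \<in> elts (carrier (N i))" "\<forall>\<^sub>F i in F. y i \<in> elts (carrier (N i))" for x y
    proof
      have cx: "\<And>i. c x i \<in> elts (carrier (N i))" "\<forall>\<^sub>F i in F. c x i = x i"
        and cy: "\<And>i. c y i \<in> elts (carrier (N i))" "\<forall>\<^sub>F i in F. c y i = y i"
        using c[of x] c[of y] that by auto
      assume "q x = q y"
      \<comment> \<open>Injectivity of \<open>e\<close> on \<open>I\<close> lets the values of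
        \<open>c x\<close> and \<open>c y\<close> be read off from the common graph.\<close>
      then have img: "(\<lambda>i. vpair (e i) (c x i)) ` I = (\<lambda>i. vpair (e i) (c y i)) ` I"
        using elts_graph[of "c x", OF cx(1)] elts_graph[of "c y", OF cy(1)] by (simp add: q_def)
      have "\<forall>i\<in>I. c x i = c y i"
      proof
        fix i
        assume i: "i \<in> I"
        with img have "vpair (e i) (c x i) \<in> (\<lambda>i. vpair (e i) (c y i)) ` I"
          by blast
        then show "c x i = c y i"
          using e(1) i by (auto dest: inj_onD)
      qed
      with I cx(2) cy(2) show "\<forall>\<^sub>F i in F. x i = y i"
        by (auto elim: eventually_elim2 [OF eventually_conj])
    next
      assume eq: "\<forall>\<^sub>F i in F. x i = y i"
      have "(\<forall>\<^sub>F i in F. z i = x i) \<longleftrightarrow> (\<forall>\<^sub>F i in F. z i = y i)" for z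
        by (rule eventually_subst) (use eq in eventually_elim, simp)
      then show "q x = q y"
        by (simp add: q_def c_def)
    qed
  qed (use ultra N(1) elts_D in auto)
  ultimately show thesis
    by (rule that[rotated])
qed

subsection \<open>Finite patterns in elementarily equivalent categories\<close>

lemma eval_cong:
  "(\<forall>n\<in>fov_obj t. a n = a' n) \<Longrightarrow> (\<forall>n\<in>fmv_obj t. b n = b' n) \<Longrightarrow> eval_obj C a b t = eval_obj C a' b' t"
  "(\<forall>n\<in>fov_mor u. a n = a' n) \<Longrightarrow> (\<forall>n\<in>fmv_mor u. b n = b' n) \<Longrightarrow> eval_mor C a b u = eval_mor C a' b' u"
  by (induction t and u) auto

lemma cat_sat_cong:
  "(\<And>n. n \<in> fov p \<Longrightarrow> a n = a' n) \<Longrightarrow> (\<And>n. n \<in> fmv p \<Longrightarrow> b n = b' n) \<Longrightarrow>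
    cat_sat C a b p \<longleftrightarrow> cat_sat C a' b' p"
proof (induction p arbitrary: a a' b b')
  case (OEq t u)
  then show ?case
    using eval_cong(1)[of t a a' b b'] eval_cong(1)[of u a a' b b'] by simp
next
  case (MEq t u)
  then show ?case
    using eval_cong(2)[of t a a' b b'] eval_cong(2)[of u a a' b b'] by simp
next
  case (CompF t u v)
  then show ?case
    using eval_cong(2)[of t a a' b b'] eval_cong(2)[of u a a' b b'] eval_cong(2)[of v a a' b b']
    by simp
next
  case (CNeg p)
  from CNeg.IH[of a a' b b'] CNeg.prems show ?case
    by simp
next
  case (CConj p q)
  from CConj.IH[of a a' b b'] CConj.prems show ?case
    by simp
next
  case (OEx n p)
  have "cat_sat C (a(n := x)) b p \<longleftrightarrow> cat_sat C (a'(n := x)) b' p" for x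
    using OEx.prems by (intro OEx.IH) auto
  then show ?case
    by simp
next
  case (MEx n p)
  have "cat_sat C a (b(n := x)) p \<longleftrightarrow> cat_sat C a' (b'(n := x)) p" for x
    using MEx.prems by (intro MEx.IH) auto
  then show ?case
    by simp
qed

lemma cat_true_iff: "cat_sentence p \<Longrightarrow> cat_true C p \<longleftrightarrow> cat_sat C a b p"
  using cat_sat_cong[of p] unfolding cat_true_def cat_sentence_def by blast

lemma cat_sat_MExs:
  "cat_sat C a b (foldr MEx ks p) \<longleftrightarrow>
    (\<exists>b'. (\<forall>k\<in>set ks. b' k \<in> Mor C) \<and> (\<forall>k. k \<notin> set ks \<longrightarrow> b' k = b k) \<and> cat_sat C a b' p)"
proof (induction ks arbitrary: b)
  case Nil
  have "b' = b \<longleftrightarrow> (\<forall>k. b' k = b k)" for b' :: "nat \<Rightarrow> 'a"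
    by auto
  then show ?case
    by (simp flip: ex_simps) metis
next
  case (Cons j ks)
  show ?case (is "_ \<longleftrightarrow> ?r")
  proof
    assume "cat_sat C a b (foldr MEx (j # ks) p)"
    then obtain x b' where "x \<in> Mor C" "\<forall>k\<in>set ks. b' k \<in> Mor C"
      "\<forall>k. k \<notin> set ks \<longrightarrow> b' k = (b(j := x)) k" "cat_sat C a b' p"
      by (auto simp: Cons.IH)
    then show ?r
      by (intro exI[of _ b']) (auto simp: fun_upd_def split: if_splits)
  next
    assume ?r
    then obtain b' where "\<forall>k\<in>set (j # ks). b' k \<in> Mor C"
      "\<forall>k. k \<notin> set (j # ks) \<longrightarrow> b' k = b k" "cat_sat C a b' p"
      by blast
    then show "cat_sat C a b (foldr MEx (j # ks) p)"
      by (auto simp: Cons.IH intro!: bexI[of _ "b' j"] exI[of _ b'])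
  qed
qed

lemma fov_MExs: "fov (foldr MEx ks p) = fov p" and fmv_MExs: "fmv (foldr MEx ks p) = fmv p - set ks"
  by (induction ks) auto

text \<open>The formula is chosen before the category, so the same one can be read in
  \<open>C\<close> and in \<open>M\<close>. The bound \<open>0 < n\<close> leaves room for variable
  0, used in \<open>MEq (MVar 0) (MVar 0)\<close> as the empty conjunction.\<close>

lemma conjunction_exists:
  assumes "finite P" "0 < n" "\<And>p. p \<in> P \<Longrightarrow> fov p = {} \<and> fmv p \<subseteq> {..<n}"
  shows "\<exists>c. fov c = {} \<and> fmv c \<subseteq> {..<n} \<and>
    (\<forall>(C :: 'v cat_struct) a b. cat_sat C a b c \<longleftrightarrow> (\<forall>p\<in>P. cat_sat C a b p))"
  using assms
proof (induction P)
  case empty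
  then show ?case
    by (intro exI[of _ "MEq (MVar 0) (MVar 0)"]) auto
next
  case (insert p P)
  then obtain c where "fov c = {}" "fmv c \<subseteq> {..<n}"
    "\<And>(C :: 'v cat_struct) a b. cat_sat C a b c \<longleftrightarrow> (\<forall>p\<in>P. cat_sat C a b p)"
    by (metis insertI2)
  with insert.prems show ?case
    by (intro exI[of _ "CConj p c"]) auto
qed

text \<open>Each formula of \<open>P\<close> or its negation holds in \<open>C\<close> at
  \<open>f\<close>. The existential closure of the conjunction of these is a sentence true in
  \<open>C\<close>, hence in \<open>M\<close>, and \<open>g\<close> consists of the witnesses
  there.\<close>

lemma elem_equiv_realize:
  fixes C M :: "'v cat_struct"
  assumes equiv: "elem_equiv C M" and "finite P" "0 < n"
    and P: "\<And>p. p \<in> P \<Longrightarrow> fov p = {} \<and> fmv p \<subseteq> {..<n}"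
    and f: "\<And>i. i < n \<Longrightarrow> f i \<in> Mor C"
  obtains g where "\<And>i. i < n \<Longrightarrow> g i \<in> Mor M"
    "\<And>p a. p \<in> P \<Longrightarrow> cat_sat M a g p \<longleftrightarrow> cat_sat C a f p"
proof -
  \<comment> \<open>The formulas of \<open>P\<close> have no free object variables, so
    \<open>undefined\<close> serves as object assignment.\<close>
  define lit where "lit p = (if cat_sat C undefined f p then p else CNeg p)" for p
  have "\<exists>c. fov c = {} \<and> fmv c \<subseteq> {..<n} \<and>
    (\<forall>(C :: 'v cat_struct) a b. cat_sat C a b c \<longleftrightarrow> (\<forall>p\<in>lit ` P. cat_sat C a b p))"
    using assms(2,3) P by (intro conjunction_exists) (fastforce simp: lit_def split: if_splits)+
  then obtain c where c: "fov c = {}" "fmv c \<subseteq> {..<n}"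
    and sat_c: "\<And>(C :: 'v cat_struct) a b. cat_sat C a b c \<longleftrightarrow> (\<forall>p\<in>lit ` P. cat_sat C a b p)"
    by blast
  let ?s = "foldr MEx [0..<n] c"
  have s: "cat_sentence ?s"
    using c by (auto simp: cat_sentence_def fov_MExs fmv_MExs)
  have "cat_sat C undefined f ?s"
    unfolding cat_sat_MExs sat_c using f by (intro exI[of _ f]) (auto simp: lit_def)
  then have "cat_sat M undefined undefined ?s"
    using equiv cat_true_iff[OF s] s unfolding elem_equiv_def by metis
  then obtain g where g: "\<And>i. i < n \<Longrightarrow> g i \<in> Mor M" "\<And>p. p \<in> P \<Longrightarrow> cat_sat M undefined g (lit p)"
    by (force simp: cat_sat_MExs sat_c)
  have "cat_sat M a g p \<longleftrightarrow> cat_sat C a f p" if "p \<in> P" for p a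
  proof -
    have "cat_sat M a g p \<longleftrightarrow> cat_sat M undefined g p" "cat_sat C a f p \<longleftrightarrow> cat_sat C undefined f p"
      using P[OF that] by (auto intro!: cat_sat_cong)
    with g(2)[OF that] show ?thesis
      by (auto simp: lit_def split: if_splits)
  qed
  with g(1) that show thesis
    by blast
qed

text \<open>The fragment of the atomic diagram on \<open>s\<close> that decides injectivity, sources
  and targets, identities and composites. Objects occur only as \<open>Dom\<close> or
  \<open>Rng\<close> of a morphism; an object \<open>A\<close> will be represented by its identity,
  and targets are compared with the source of such an identity.\<close>

definition pattern_on :: "'v cat_struct \<Rightarrow> 'v cat_struct \<Rightarrow> 'v set \<Rightarrow> ('v \<Rightarrow> 'v) \<Rightarrow> bool" where
  "pattern_on C M s b \<longleftrightarrow> (\<forall>f\<in>s. \<forall>g\<in>s. \<forall>h\<in>s.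
     (b f = b g \<longleftrightarrow> f = g) \<and>
     (Dom M (b f) = Dom M (b g) \<longleftrightarrow> Dom C f = Dom C g) \<and>
     (Rng M (b f) = Dom M (b g) \<longleftrightarrow> Rng C f = Dom C g) \<and>
     (Ident M (Dom M (b f)) = b g \<longleftrightarrow> Ident C (Dom C f) = g) \<and>
     (Dom M (b g) = Rng M (b f) \<and> Comp M (b g) (b f) = b h \<longleftrightarrow> Dom C g = Rng C f \<and> Comp C g f = h))"

lemma pattern_on_subset:
  assumes "pattern_on C M s b" "X \<subseteq> s"
  shows "pattern_on C M X b"
  unfolding pattern_on_def
proof (intro ballI)
  fix f g h
  assume "f \<in> X" "g \<in> X" "h \<in> X"
  then have "f \<in> s" "g \<in> s" "h \<in> s"
    using assms(2) by auto
  from assms(1)[unfolded pattern_on_def, rule_format, OF this]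
  show "(b f = b g \<longleftrightarrow> f = g) \<and>
     (Dom M (b f) = Dom M (b g) \<longleftrightarrow> Dom C f = Dom C g) \<and>
     (Rng M (b f) = Dom M (b g) \<longleftrightarrow> Rng C f = Dom C g) \<and>
     (Ident M (Dom M (b f)) = b g \<longleftrightarrow> Ident C (Dom C f) = g) \<and>
     (Dom M (b g) = Rng M (b f) \<and> Comp M (b g) (b f) = b h \<longleftrightarrow> Dom C g = Rng C f \<and> Comp C g f = h)" .
qed

lemma elem_equiv_finite_pattern:
  assumes equiv: "elem_equiv C M" and s: "finite s" "s \<subseteq> Mor C" and ne: "Mor C \<noteq> {}"
  shows "\<exists>b. (\<forall>f\<in>Mor C. b f \<in> Mor M) \<and> pattern_on C M s b"
proof -
  obtain m where m: "m \<in> Mor C"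
    using ne by blast
  \<comment> \<open>Adding \<open>m\<close> makes the set nonempty, so index 0 exists and can be the
    default for morphisms outside \<open>t\<close>; the map then takes values in
    \<open>Mor M\<close> on all of \<open>Mor C\<close>.\<close>
  define t where "t = insert m s"
  have "finite t"
    using s(1) by (simp add: t_def)
  from finite_imp_nat_seg_image_inj_on[OF this]
  obtain n and f :: "nat \<Rightarrow> 'a" where f: "t = f ` {i. i < n}"
    by blast
  have n: "0 < n"
    using f(1) by (cases n) (auto simp: t_def)
  have fC: "f i \<in> Mor C" if "i < n" for i
    using f(1) that s(2) m by (auto simp: t_def)
  \<comment> \<open>All instances of the clauses of \<open>pattern_on\<close>, with variable
    \<open>i\<close> standing for the morphism \<open>f i\<close>.\<close>
  define P where "P = (\<Union>i<n. \<Union>j<n. \<Union>k<n. {MEq (MVar i) (MVar j), OEq (DomT (MVar i)) (DomT (MVar j)),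
    OEq (RngT (MVar i)) (DomT (MVar j)), MEq (IdT (DomT (MVar i))) (MVar j),
    CompF (MVar j) (MVar i) (MVar k)})"
  have "finite P"
    unfolding P_def by (intro finite_UN_I finite_lessThan) simp
  have fv_P: "fov p = {} \<and> fmv p \<subseteq> {..<n}" if "p \<in> P" for p
    using that unfolding P_def by fastforce
  obtain g where g: "\<And>i. i < n \<Longrightarrow> g i \<in> Mor M"
    and sat: "\<And>p a. p \<in> P \<Longrightarrow> cat_sat M a g p \<longleftrightarrow> cat_sat C a f p"
    by (rule elem_equiv_realize[OF equiv \<open>finite P\<close> n, of f]) (auto dest: fv_P intro: fC)
  define idx where "idx x = (if x \<in> t then inv_into {i. i < n} f x else 0)" for x
  have idx: "idx x < n" for x
    using inv_into_into[of x f "{i. i < n}"] f(1) n by (auto simp: idx_def)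
  have f_idx: "f (idx x) = x" if "x \<in> s" for x
    using that f(1) f_inv_into_f[of x f "{i. i < n}"] by (auto simp: idx_def t_def)
  have "pattern_on C M s (\<lambda>x. g (idx x))"
    unfolding pattern_on_def
  proof (intro ballI)
    fix x y z
    assume xyz: "x \<in> s" "y \<in> s" "z \<in> s"
    let ?i = "idx x" and ?j = "idx y" and ?k = "idx z"
    have "MEq (MVar ?i) (MVar ?j) \<in> P" "OEq (DomT (MVar ?i)) (DomT (MVar ?j)) \<in> P"
      "OEq (RngT (MVar ?i)) (DomT (MVar ?j)) \<in> P" "MEq (IdT (DomT (MVar ?i))) (MVar ?j) \<in> P"
      "CompF (MVar ?j) (MVar ?i) (MVar ?k) \<in> P"
      using idx[of x] idx[of y] idx[of z] unfolding P_def by blast+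
    from this[THEN sat, of undefined] xyz[THEN f_idx]
    show "(g (idx x) = g (idx y) \<longleftrightarrow> x = y) \<and>
      (Dom M (g (idx x)) = Dom M (g (idx y)) \<longleftrightarrow> Dom C x = Dom C y) \<and>
      (Rng M (g (idx x)) = Dom M (g (idx y)) \<longleftrightarrow> Rng C x = Dom C y) \<and>
      (Ident M (Dom M (g (idx x))) = g (idx y) \<longleftrightarrow> Ident C (Dom C x) = y) \<and>
      (Dom M (g (idx y)) = Rng M (g (idx x)) \<and> Comp M (g (idx y)) (g (idx x)) = g (idx z) \<longleftrightarrow>
        Dom C y = Rng C x \<and> Comp C y x = z)"
      by simp
  qed
  then show ?thesis
    by (intro exI[of _ "\<lambda>x. g (idx x)"] conjI ballI g idx)
qed

text \<open>For finite \<open>X\<close>, the finite sets containing \<open>X\<close> form a member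
  of \<open>finite_subsets_at_top (Mor C)\<close>, hence of the finer ultrafilter, and a pattern on
  a larger set restricts to \<open>X\<close>.\<close>

lemma elem_equiv_pattern:
  fixes C M :: "'v cat_struct"
  assumes equiv: "elem_equiv C M" and ne: "Mor C \<noteq> {}"
  obtains F :: "'v set filter" and b where "ultra F" "F \<le> finite_subsets_at_top (Mor C)"
    "\<And>s f. f \<in> Mor C \<Longrightarrow> b s f \<in> Mor M"
    "\<And>X. finite X \<Longrightarrow> X \<subseteq> Mor C \<Longrightarrow> \<forall>\<^sub>F s in F. pattern_on C M X (b s)"
proof -
  obtain F where F: "F \<le> finite_subsets_at_top (Mor C)" "ultra F"
    using ultrafilter_extension[OF finite_subsets_at_top_neq_bot] by blast
  \<comment> \<open>The indices range over all collections. If \<open>s\<close> is not a finite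
    subset of \<open>Mor C\<close>, the map belonging to the empty set is taken, so values lie in
    \<open>Mor M\<close> for every index.\<close>
  have "\<forall>s. \<exists>b. (\<forall>f\<in>Mor C. b f \<in> Mor M) \<and> (finite s \<and> s \<subseteq> Mor C \<longrightarrow> pattern_on C M s b)"
  proof
    fix s
    show "\<exists>b. (\<forall>f\<in>Mor C. b f \<in> Mor M) \<and> (finite s \<and> s \<subseteq> Mor C \<longrightarrow> pattern_on C M s b)"
      using elem_equiv_finite_pattern[OF equiv _ _ ne, of s]
        elem_equiv_finite_pattern[OF equiv finite.emptyI empty_subsetI ne]
      by (cases "finite s \<and> s \<subseteq> Mor C") auto
  qed
  then obtain b where b: "\<And>s f. f \<in> Mor C \<Longrightarrow> b s f \<in> Mor M"
    "\<And>s. finite s \<Longrightarrow> s \<subseteq> Mor C \<Longrightarrow> pattern_on C M s (b s)"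
    by metis
  have "\<forall>\<^sub>F s in F. pattern_on C M X (b s)" if X: "finite X" "X \<subseteq> Mor C" for X
  proof (rule filter_leD[OF F(1)])
    show "\<forall>\<^sub>F s in finite_subsets_at_top (Mor C). pattern_on C M X (b s)"
      unfolding eventually_finite_subsets_at_top
    proof (intro exI[of _ X] conjI allI impI X; elim conjE)
      fix s
      assume "finite s" "X \<subseteq> s" "s \<subseteq> Mor C"
      with b(2)[of s] show "pattern_on C M X (b s)"
        by (blast intro: pattern_on_subset)
    qed
  qed
  with F b(1) that show thesis
    by blast
qed

subsection \<open>The embedding\<close>

text \<open>Treats both kinds of morphisms at once: all that is asked of \<open>hom\<close> is that
  it consists of homomorphisms and passes to ultraproducts over an ultrafilter on collections of
  morphisms.\<close>

lemma (in univ) universal_models_with: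
  fixes L :: 'v and T :: "'v fm set"
  assumes L: "language L" "L \<in> elts U" and T: "theory_in L T"
    and hom: "\<And>M N h. hom M N h \<Longrightarrow> homomorphism L M N h"
    and hom_prod_map: "\<And>F N q D N' q' D' h.
      ultraproduct_map L (F :: 'v set filter) N q D N' q' D' h \<Longrightarrow>
      \<forall>\<^sub>F i in F. hom (N i) (N' i) (h i) \<Longrightarrow>
      hom (ultraproduct.prod L F N q D) (ultraproduct.prod L F N' q' D')
        (ultraproduct_map.prod_map F N q D q' h)"
  shows "universal_category U (models_with hom U L T)" (is "universal_category U ?M")
  unfolding universal_category_def
proof (intro conjI allI impI; (elim conjE)?)
  show "Obj ?M \<subseteq> elts U"
    using struct_in_univ[OF L] by (auto simp: models_with_def model_of_def)
  show "Mor ?M \<subseteq> elts U"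
  proof
    fix f
    assume "f \<in> Mor ?M"
    then obtain M h N where f: "f = vpair M (vpair h N)"
      and MN: "struct L M" "small_struct U M" "struct L N" "small_struct U N" and h: "hom M N h"
      by (auto simp: models_with_def model_of_def)
    have "h \<in> elts U"
      using vfunction_in_univ[of h "elts (carrier M)" "elts (carrier N)"] hom[OF h] MN
      by (simp add: homomorphism_def small_struct_def)
    then show "f \<in> elts U"
      unfolding f using struct_in_univ[OF L] MN by (intro vpair_in_univ) auto
  qed
  fix C
  assume "small_category U C" and equiv: "elem_equiv C ?M"
  then have C: "category C" and Obj_C: "in_univ U (Obj C)" and Mor_C: "in_univ U (Mor C)"
    by (auto simp: small_category_def in_univ_def)
  show "\<exists>\<Phi> \<phi>. cat_embedding C ?M \<Phi> \<phi>"
  \<comment> \<open>Without morphisms there are no identities, hence no objects, and any two maps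
    form an embedding. Finite patterns need at least one morphism.\<close>
  proof (cases "Mor C = {}")
    case True
    then have "Obj C = {}"
      using C by (auto simp: category_def)
    with True show ?thesis
      by (auto simp: cat_embedding_def is_functor_def)
  next
    case False
    obtain F b where F: "ultra F" "F \<le> finite_subsets_at_top (Mor C)"
      and b: "\<And>s f. f \<in> Mor C \<Longrightarrow> b s f \<in> Mor ?M"
      and pattern: "\<And>X. finite X \<Longrightarrow> X \<subseteq> Mor C \<Longrightarrow> \<forall>\<^sub>F s in F. pattern_on C ?M X (b s)"
      by (rule elem_equiv_pattern[OF equiv False]) (rule that)
    have pat: "\<forall>\<^sub>F s in F.
       (b s f = b s g \<longleftrightarrow> f = g) \<and>
       (Dom ?M (b s f) = Dom ?M (b s g) \<longleftrightarrow> Dom C f = Dom C g) \<and>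
       (Rng ?M (b s f) = Dom ?M (b s g) \<longleftrightarrow> Rng C f = Dom C g) \<and>
       (Ident ?M (Dom ?M (b s f)) = b s g \<longleftrightarrow> Ident C (Dom C f) = g) \<and>
       (Dom ?M (b s g) = Rng ?M (b s f) \<and> Comp ?M (b s g) (b s f) = b s h \<longleftrightarrow>
         Dom C g = Rng C f \<and> Comp C g f = h)"
      if "f \<in> Mor C" "g \<in> Mor C" "h \<in> Mor C" for f g h
    proof -
      have "\<forall>\<^sub>F s in F. pattern_on C ?M {f, g, h} (b s)"
        using that by (intro pattern) auto
      then show ?thesis
        by eventually_elim (simp add: pattern_on_def)
    qed
    have Ident_C: "Ident C A \<in> Mor C" "Dom C (Ident C A) = A" "Rng C (Ident C A) = A" if "A \<in> Obj C" for A
      using C that by (auto simp: category_def)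
    have Mor_C': "Dom C f \<in> Obj C" "Rng C f \<in> Obj C" if "f \<in> Mor C" for f
      using C that by (auto simp: category_def)
    have Dom_M: "Dom ?M = vfst" and Rng_M: "Rng ?M = (\<lambda>m. vsnd (vsnd m))"
      by (simp_all add: models_with_def)

    \<comment> \<open>The factor at \<open>s\<close> is the source of the morphism assigned to the
      identity of \<open>A\<close>. It is a model for every \<open>s\<close>, since
      \<open>b s\<close> maps into \<open>Mor ?M\<close> even where the pattern fails.\<close>
    define N where "N A s = vfst (b s (Ident C A))" for A s
    have N: "model_of L T (N A s)" "struct L (N A s)" "carrier (N A s) \<in> elts U"
      if "A \<in> Obj C" for A s
      using b[OF Ident_C(1)[OF that], of s]
      by (auto simp: models_with_def N_def model_of_def small_struct_def)

    \<comment> \<open>Finite subsets of the small set \<open>Mor C\<close> are coded by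
      \<open>vset\<close>, and the codes lie in its power set; this makes the index set
      small.\<close>
    define I where "I = {s. finite s \<and> s \<subseteq> Mor C}"
    have I: "\<forall>\<^sub>F s in F. s \<in> I"
      by (rule filter_leD[OF F(2)])
        (auto simp: eventually_finite_subsets_at_top I_def)
    have I_set: "is_set s" if "s \<in> I" for s
      using that is_set_subset[OF in_univ_is_set[OF Mor_C]] by (auto simp: I_def)
    have inj_I: "inj_on vset I"
      by (rule inj_onI) (simp add: I_set vset_eq_iff)
    have univ_I: "in_univ U (vset ` I)"
      by (rule in_univ_subset[OF in_univ_Pow[OF Mor_C]]) (use I_set in \<open>auto simp: I_def\<close>)
    have "\<forall>A\<in>Obj C. \<exists>q D. ultraproduct L F (N A) q D \<and> D \<in> elts U \<and> (\<forall>z\<in>elts D. vfst z = A)"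
    proof
      fix A
      assume A: "A \<in> Obj C"
      then have "A \<in> elts U"
        using Obj_C by (auto simp: in_univ_def intro: transitive)
      then obtain q D where "ultraproduct L F (N A) q D" "D \<in> elts U" "\<And>z. z \<in> elts D \<Longrightarrow> vfst z = A"
        by (rule ultraproduct_in_univ[OF F(1) I inj_I univ_I _ N(2,3)[OF A]]) (rule that)
      then show "\<exists>q D. ultraproduct L F (N A) q D \<and> D \<in> elts U \<and> (\<forall>z\<in>elts D. vfst z = A)"
        by blast
    qed
    then obtain q D where up: "\<And>A. A \<in> Obj C \<Longrightarrow> ultraproduct L F (N A) (q A) (D A)"
      and D: "\<And>A. A \<in> Obj C \<Longrightarrow> D A \<in> elts U" "\<And>A z. A \<in> Obj C \<Longrightarrow> z \<in> elts (D A) \<Longrightarrow> vfst z = A"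
      by metis

    define \<Phi> where "\<Phi> A = ultraproduct.prod L F (N A) (q A) (D A)" for A
    define h where "h f s = vfst (vsnd (b s f))" for f s
    define H where "H f = ultraproduct_map.prod_map F (N (Dom C f)) (q (Dom C f)) (D (Dom C f))
      (q (Rng C f)) (h f)" for f
    define \<phi> where "\<phi> f = vpair (\<Phi> (Dom C f)) (vpair (H f) (\<Phi> (Rng C f)))" for f

    \<comment> \<open>For almost all \<open>s\<close> the pattern matches the source and target of
      \<open>b s f\<close> with the sources assigned to the identities of \<open>Dom C f\<close> and
      \<open>Rng C f\<close>, which are the factors \<open>N\<close>.\<close>
    have b_eq: "\<forall>\<^sub>F s in F. b s f = vpair (N (Dom C f) s) (vpair (h f s) (N (Rng C f) s)) \<and>
        hom (N (Dom C f) s) (N (Rng C f) s) (h f s)"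
      if f: "f \<in> Mor C" for f
      using pat[OF f Ident_C(1)[OF Mor_C'(1)[OF f]] f] pat[OF f Ident_C(1)[OF Mor_C'(2)[OF f]] f]
    proof eventually_elim
      case (elim s)
      then have "vfst (b s f) = N (Dom C f) s" "vsnd (vsnd (b s f)) = N (Rng C f) s"
        unfolding Dom_M Rng_M using Ident_C(2) Mor_C'[OF f] by (simp_all add: N_def)
      with b[OF f, of s] show ?case
        by (auto simp: models_with_def h_def)
    qed
    have upm: "ultraproduct_map L F (N (Dom C f)) (q (Dom C f)) (D (Dom C f))
        (N (Rng C f)) (q (Rng C f)) (D (Rng C f)) (h f)"
      if f: "f \<in> Mor C" for f
    proof -
      from b_eq[OF f] have "\<forall>\<^sub>F s in F. vfunction (h f s)
          (elts (carrier (N (Dom C f) s))) (elts (carrier (N (Rng C f) s)))"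
        by eventually_elim (auto dest: hom simp: homomorphism_def)
      then show ?thesis
        by (intro ultraproduct_map.intro ultraproduct_map_axioms.intro up Mor_C' f)
    qed
    have carrier_\<Phi>: "carrier (\<Phi> A) = D A" if "A \<in> Obj C" for A
      unfolding \<Phi>_def by (rule ultraproduct.carrier_prod[OF up[OF that]])
    have \<Phi>_obj: "model_of L T (\<Phi> A)" "small_struct U (\<Phi> A)" if "A \<in> Obj C" for A
      unfolding small_struct_def carrier_\<Phi>[OF that] using that D N
      by (auto simp: \<Phi>_def intro: ultraproduct.model_of_prod[OF up T])
    have hom_H: "hom (\<Phi> (Dom C f)) (\<Phi> (Rng C f)) (H f)" if "f \<in> Mor C" for f
      unfolding \<Phi>_def H_def
      by (rule hom_prod_map[OF upm[OF that]]) (use b_eq[OF that] in \<open>auto elim: eventually_mono\<close>)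
    have vfunction_H: "vfunction (H f) (elts (D (Dom C f))) (elts (D (Rng C f)))" if "f \<in> Mor C" for f
      unfolding H_def by (rule ultraproduct_map.vfunction_prod_map[OF upm[OF that]])
    have vapp_H: "vapp (H f) (q (Dom C f) x) = q (Rng C f) (\<lambda>s. vapp (h f s) (x s))"
      if "f \<in> Mor C" "x \<in> ultraproduct.fam F (N (Dom C f))" for f x
      unfolding H_def by (rule ultraproduct_map.vapp_prod_map[OF upm[OF that(1)] that(2)])
    have fam_h: "(\<lambda>s. vapp (h f s) (x s)) \<in> ultraproduct.fam F (N (Rng C f))"
      if "f \<in> Mor C" "x \<in> ultraproduct.fam F (N (Dom C f))" for f x
      by (rule ultraproduct_map.fam_vapp[OF upm[OF that(1)] that(2)])
    have elts_D: "elts (D A) = q A ` ultraproduct.fam F (N A)" if "A \<in> Obj C" for A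
      by (rule ultraproduct.elts_D_fam[OF up[OF that]])
    have q_cong: "q A x = q A y"
      if "A \<in> Obj C" "x \<in> ultraproduct.fam F (N A)" "\<forall>\<^sub>F s in F. x s = y s" for A x y
      using ultraproduct.q_cong[OF up[OF that(1)] that(2,3)] by blast
    have fam_D: "\<forall>\<^sub>F s in F. x s \<in> elts (carrier (N A s))"
      if "A \<in> Obj C" "x \<in> ultraproduct.fam F (N A)" for A x
      using that(2) unfolding ultraproduct.fam_def[OF up[OF that(1)]] by simp

    \<comment> \<open>Functoriality, checked on classes of families\<close>
    have "is_functor C ?M \<Phi> \<phi>"
      unfolding is_functor_def
    proof (intro conjI ballI impI)
      show "\<Phi> A \<in> Obj ?M" if "A \<in> Obj C" for A
        using \<Phi>_obj[OF that] by (simp add: models_with_def)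
    next
      fix f
      assume f: "f \<in> Mor C"
      show "Dom ?M (\<phi> f) = \<Phi> (Dom C f)" "Rng ?M (\<phi> f) = \<Phi> (Rng C f)"
        by (simp_all add: \<phi>_def Dom_M Rng_M)
      show "\<phi> f \<in> Mor ?M"
        using \<Phi>_obj Mor_C'[OF f] hom_H[OF f] by (auto simp: models_with_def \<phi>_def)
    next
      fix A
      assume A: "A \<in> Obj C"
      note id = Ident_C[OF A]
      have "H (Ident C A) = vlambda (D A) (\<lambda>x. x)"
      proof (rule vfunction_ext)
        show "vfunction (H (Ident C A)) (elts (D A)) (elts (D A))"
          using vfunction_H[OF id(1)] by (simp add: id)
        show "vfunction (vlambda (D A) (\<lambda>x. x)) (elts (D A)) UNIV"
          by (rule vfunction_vlambda) simp
        fix z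
        assume z: "z \<in> elts (D A)"
        then obtain x where x: "z = q A x" "x \<in> ultraproduct.fam F (N A)"
          by (auto simp: elts_D[OF A])
        have "\<forall>\<^sub>F s in F. x s = vapp (h (Ident C A) s) (x s)"
          using pat[OF id(1) id(1) id(1)] fam_D[OF A x(2)]
        proof eventually_elim
          case (elim s)
          then have "Ident ?M (N A s) = b s (Ident C A)"
            using id by (simp add: Dom_M N_def)
          then have "h (Ident C A) s = vfst (vsnd (Ident ?M (N A s)))"
            by (simp add: h_def)
          then have "h (Ident C A) s = vlambda (carrier (N A s)) (\<lambda>x. x)"
            by (simp add: models_with_def)
          with elim show ?case
            by simp
        qed
        from q_cong[OF A x(2) this] show "vapp (H (Ident C A)) z = vapp (vlambda (D A) (\<lambda>x. x)) z"
          using vapp_H[OF id(1), of x] x z by (simp add: id)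
      qed
      then show "\<phi> (Ident C A) = Ident ?M (\<Phi> A)"
        by (simp add: \<phi>_def id models_with_def carrier_\<Phi>[OF A])
    next
      fix f g
      assume f: "f \<in> Mor C" and g: "g \<in> Mor C" and fg: "Dom C g = Rng C f"
      let ?k = "Comp C g f"
      have k: "?k \<in> Mor C" "Dom C ?k = Dom C f" "Rng C ?k = Rng C g"
        using C f g fg by (auto simp: category_def)
      have A: "Dom C f \<in> Obj C"
        using Mor_C' f by blast
      have "H ?k = vlambda (D (Dom C f)) (\<lambda>z. vapp (H g) (vapp (H f) z))"
      proof (rule vfunction_ext)
        show "vfunction (H ?k) (elts (D (Dom C f))) (elts (D (Rng C g)))"
          using vfunction_H[OF k(1)] by (simp add: k)
        show "vfunction (vlambda (D (Dom C f)) (\<lambda>z. vapp (H g) (vapp (H f) z)))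
            (elts (D (Dom C f))) UNIV"
          by (rule vfunction_vlambda) simp
        fix z
        assume z: "z \<in> elts (D (Dom C f))"
        then obtain x where x: "z = q (Dom C f) x" "x \<in> ultraproduct.fam F (N (Dom C f))"
          by (auto simp: elts_D[OF A])
        have hx: "(\<lambda>s. vapp (h f s) (x s)) \<in> ultraproduct.fam F (N (Dom C g))"
          using fam_h[OF f x(2)] by (simp add: fg)
        have "\<forall>\<^sub>F s in F. vapp (h ?k s) (x s) = vapp (h g s) (vapp (h f s) (x s))"
          using pat[OF f g k(1)] fam_D[OF A x(2)] b_eq[OF f]
        proof eventually_elim
          case (elim s)
          then have "Comp ?M (b s g) (b s f) = b s ?k"
            using fg by simp
          then have "h ?k s = vfst (vsnd (Comp ?M (b s g) (b s f)))"
            by (simp add: h_def)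
          \<comment> \<open>The composite in \<open>?M\<close> is a \<open>vlambda\<close> over the
            carrier of the source of \<open>b s f\<close>; identifying this source puts
            \<open>x s\<close> into its domain.\<close>
          moreover have "vfst (b s f) = N (Dom C f) s"
            by (subst conjunct1[OF elim(3)]) simp
          ultimately have "h ?k s = vlambda (carrier (N (Dom C f) s)) (\<lambda>x. vapp (h g s) (vapp (h f s) x))"
            by (simp add: models_with_def h_def)
          with elim show ?case
            by simp
        qed
        from q_cong[OF Mor_C'(2)[OF k(1)] fam_h[OF k(1)] this]
        show "vapp (H ?k) z = vapp (vlambda (D (Dom C f)) (\<lambda>z. vapp (H g) (vapp (H f) z))) z"
          using vapp_H[OF k(1), of x] vapp_H[OF f x(2)] vapp_H[OF g hx] x z by (simp add: k fg)
      qed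
      then show "\<phi> ?k = Comp ?M (\<phi> g) (\<phi> f)"
        by (simp add: \<phi>_def k models_with_def carrier_\<Phi>[OF A])
    qed

    \<comment> \<open>Injectivity on objects and on morphisms\<close>
    moreover have inj_\<Phi>: "inj_on \<Phi> (Obj C)"
    proof (rule inj_onI)
      fix A B
      assume A: "A \<in> Obj C" and B: "B \<in> Obj C" and "\<Phi> A = \<Phi> B"
      \<comment> \<open>Every element of \<open>D A\<close> carries the tag \<open>A\<close>, so one
        element of the common carrier reveals the object.\<close>
      then have "D A = D B"
        using carrier_\<Phi> by metis
      moreover obtain z where "z \<in> elts (D A)"
        using ultraproduct.D_nonempty[OF up[OF A]] by blast
      ultimately show "A = B"
        using D(2) A B by metis
    qed
    moreover have "inj_on \<phi> (Mor C)"
    proof (rule inj_onI, rule ccontr)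
      fix f g
      assume f: "f \<in> Mor C" and g: "g \<in> Mor C" and eq: "\<phi> f = \<phi> g" and ne: "f \<noteq> g"
      \<comment> \<open>Equal images have equal source and target, so injectivity on objects makes
        \<open>f\<close> and \<open>g\<close> parallel and their maps comparable.\<close>
      have DR: "Dom C g = Dom C f" "Rng C g = Rng C f" and H: "H f = H g"
        using eq inj_on_eq_iff[OF inj_\<Phi>] Mor_C'[OF f] Mor_C'[OF g] by (simp_all add: \<phi>_def)
      define x where "x s = (SOME x. x \<in> elts (carrier (N (Dom C f) s)) \<and>
        vapp (h f s) x \<noteq> vapp (h g s) x)" for s
      have x: "\<forall>\<^sub>F s in F. x s \<in> elts (carrier (N (Dom C f) s)) \<and>
        vapp (h f s) (x s) \<noteq> vapp (h g s) (x s)"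
        using pat[OF f g g] b_eq[OF f] b_eq[OF g]
      proof eventually_elim
        case (elim s)
        let ?N = "N (Dom C f) s" and ?N' = "N (Rng C f) s"
        \<comment> \<open>Here \<open>b s f\<close> and \<open>b s g\<close> differ but share source
          and target, so the difference lies in the underlying maps.\<close>
        have "h f s \<noteq> h g s"
          using elim ne by (simp add: DR)
        moreover have "homomorphism L ?N ?N' (h f s)" "homomorphism L ?N ?N' (h g s)"
          using elim by (auto simp: DR intro: hom)
        then have "vfunction (h f s) (elts (carrier ?N)) (elts (carrier ?N'))"
          "vfunction (h g s) (elts (carrier ?N)) (elts (carrier ?N'))"
          by (simp_all add: homomorphism_def)
        ultimately have "\<exists>x. x \<in> elts (carrier ?N) \<and> vapp (h f s) x \<noteq> vapp (h g s) x"
          using vfunction_ext by blast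
        then show ?case
          unfolding x_def by (rule someI_ex)
      qed
      then have x_fam: "x \<in> ultraproduct.fam F (N (Dom C f))"
        unfolding ultraproduct.fam_def[OF up[OF Mor_C'(1)[OF f]]] by (auto elim: eventually_mono)
      then have "q (Rng C f) (\<lambda>s. vapp (h f s) (x s)) = q (Rng C f) (\<lambda>s. vapp (h g s) (x s))"
        using vapp_H[OF f, of x] vapp_H[OF g, of x] by (simp add: H DR)
      then have "\<forall>\<^sub>F s in F. vapp (h f s) (x s) = vapp (h g s) (x s)"
        using ultraproduct.q_eq_iff[OF up[OF Mor_C'(2)[OF f]]]
          fam_D[OF Mor_C'(2)[OF f] fam_h[OF f x_fam]] fam_D[OF Mor_C'(2)[OF g] fam_h[OF g]] x_fam
        by (simp add: DR)
      with x have "\<forall>\<^sub>F s in F. False"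
        by eventually_elim simp
      then show False
        using F(1) by (simp add: ultra_def trivial_limit_def)
    qed
    ultimately show ?thesis
      unfolding cat_embedding_def by blast
  qed
qed

theorem theorem6p6:
  fixes U L :: "'v::zfc" and T :: "'v fm set"
  assumes "grothendieck_universe U"
    and "language L" and "L \<in> elts U"
    and "theory_in L T"
  shows "universal_category U (Mod U L T) \<and> universal_category U (Mod_str U L T)"
proof -
  interpret univ U
    by standard (rule assms(1))
  show ?thesis
    unfolding Mod_def Mod_str_def
  proof (intro conjI universal_models_with assms)
    show "homomorphism L M N h" if "strong_homomorphism L M N h" for M N h
      using that by (simp add: strong_homomorphism_def)
  qed (use ultraproduct_map.homomorphism_prod_map ultraproduct_map.strong_homomorphism_prod_map in \<open>blast+\<close>)
qed

end
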